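(* Let $M,E\in\mathcal{K}^n$ with $\dim(E)=n$, and let $K=M+E$ (Minkowski sum). For $0\leq r\leq s\leq n$ put $$f_r^{(s)}=\sum_{q=0}^{n-s}\binom{n-s}{q}(-1)^q\,\mathrm{W}_{r+q}(K;E).$$ Then, for every choice of integers $0\leq i<j<k\leq l\leq n$, $$(k-j)f_i^{(l)}+(i-k)f_{j}^{(l)}+(j-i)f_k^{(l)}\geq 0.$$ Equality holds if and only if $\dim(M)\leq n-l+1$.
   Context: $\mathcal{K}^n$ denotes the set of all convex bodies in $\mathbb{R}^n$, i.e., all non-empty compact convex subsets of $\mathbb{R}^n$. The dimension $\dim(\cdot)$ of a convex body is the dimension of its affine hull. For $K,E\in\mathcal{K}^n$, the relative quermassintegrals $\mathrm{W}_i(K;E)$, $0\leq i\leq n$, are the coefficients defined by the relative Steiner formula $\mathrm{vol}(K+\lambda E)=\sum_{i=0}^n\binom{n}{i}\mathrm{W}_i(K;E)\lambda^i$ for all $\lambda\geq 0$, where $\mathrm{vol}$ is Lebesgue measure and $+$ is Minkowski addition; that is, $\mathrm{W}_i(K;E)$ is the mixed volume with $K$ appearing $n-i$ times and $E$ appearing $i$ times. The superscript in $f_r^{(s)}$ is only an index. *)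

theory Defs
  imports "HOL-Analysis.Analysis"
begin

definition convex_body :: "(real ^ 'n) set \<Rightarrow> bool" where
  "convex_body K \<longleftrightarrow> K \<noteq> {} \<and> compact K \<and> convex K"

text \<open>The relative Steiner formula, as a condition on a sequence \<open>w\<close> of candidate coefficients.
  On sets, \<open>+\<close> is the Minkowski sum. Only the indices up to the dimension occur in the
  formula; the other values are fixed to be \<open>0\<close> so that at most one sequence satisfies it.\<close>

definition steiner_formula :: "(real ^ 'n) set \<Rightarrow> (real ^ 'n) set \<Rightarrow> (nat \<Rightarrow> real) \<Rightarrow> bool" where
  "steiner_formula K E w \<longleftrightarrow>
     (\<forall>t::real. 0 \<le> t \<longrightarrow>
        measure lebesgue (K + (\<lambda>x. t *\<^sub>R x) ` E) =
          (\<Sum>i = 0..CARD('n). real (CARD('n) choose i) * w i * t ^ i)) \<and>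
     (\<forall>i > CARD('n). w i = 0)"

definition quermassintegral :: "(real ^ 'n) set \<Rightarrow> (real ^ 'n) set \<Rightarrow> nat \<Rightarrow> real" where
  "quermassintegral K E = (THE w. steiner_formula K E w)"

lemma steiner_formula_unique:
  fixes K E :: "(real ^ 'n) set"
  assumes v: "steiner_formula K E v" and w: "steiner_formula K E w"
  shows "v = w"
proof
  fix m
  let ?n = "CARD('n)"
  let ?c = "\<lambda>i. real (?n choose i) * (v i - w i)"
  have eq: "(\<Sum>i\<le>?n. ?c i * t ^ i) = 0" if "0 \<le> t" for t :: real
  proof -
    have "(\<Sum>i\<le>?n. real (?n choose i) * v i * t ^ i) = (\<Sum>i\<le>?n. real (?n choose i) * w i * t ^ i)"
      using v w that unfolding steiner_formula_def atLeast0AtMost by metis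
    then show ?thesis
      by (simp add: sum_subtractf algebra_simps)
  qed
  show "v m = w m"
  proof (cases "m \<le> ?n")
    case True
    have "?c m = 0"
    proof (rule ccontr)
      assume "?c m \<noteq> 0"
      then have "finite {t. (\<Sum>i\<le>?n. ?c i * t ^ i) = 0}"
        using Transcendental.polyfun_rootbound[of ?c m ?n] True by blast
      moreover have "{0::real..} \<subseteq> {t. (\<Sum>i\<le>?n. ?c i * t ^ i) = 0}"
        using eq by auto
      ultimately show False
        using infinite_Ici[of "0::real"] finite_subset by blast
    qed
    then show ?thesis using True by simp
  next
    case False
    then show ?thesis using v w by (simp add: steiner_formula_def)
  qed
qed

lemma quermassintegral_eqI:
  assumes "steiner_formula K E w"
  shows "quermassintegral K E = w"
  unfolding quermassintegral_def
  using assms steiner_formula_unique by (blast intro: the_equality)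

text \<open>In the notation of the source, \<open>quermass_diff K E s r\<close> is \<open>f\<^sub>r\<close> with upper index \<open>(s)\<close>;
  it is meant for \<open>r \<le> s \<le> CARD('n)\<close>, so that all occurring indices \<open>r + q\<close> are at most \<open>CARD('n)\<close>.\<close>

definition quermass_diff :: "(real ^ 'n) set \<Rightarrow> (real ^ 'n) set \<Rightarrow> nat \<Rightarrow> nat \<Rightarrow> real" where
  "quermass_diff K E s r =
     (\<Sum>q = 0..CARD('n) - s.
        real ((CARD('n) - s) choose q) * (-1) ^ q * quermassintegral K E (r + q))"

end

theory Submission
  imports Defs
begin

text \<open>
  The volume of \<open>M + t E\<close> is computed by a change of variables. Let \<open>g\<close> be the gradient of the
  convex function \<open>x \<mapsto> ln (\<Sum>k. 2\<^sup>-\<^sup>k exp (x \<bullet> y\<^sub>k))\<close>, where \<open>(y\<^sub>k)\<close> is a dense sequence in \<open>M\<close>, and let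
  \<open>f\<close> be the analogous gradient for \<open>E\<close>. Then \<open>g + t f\<close> maps the space injectively onto a subset of
  \<open>M + t E\<close> that contains its interior, so that \<open>vol (M + t E) = \<integral> det (g' + t f')\<close>. Here \<open>g'\<close> is positive
  semidefinite of rank \<open>dim M\<close> and \<open>f'\<close> is positive definite; diagonalizing both simultaneously, the integrand
  is a polynomial in \<open>t\<close> with nonnegative coefficients, the \<open>i\<close>-th of which vanishes iff \<open>i + dim M < n\<close>.
  Hence the \<open>W\<^sub>i(M; E)\<close> exist, are nonnegative, and \<open>W\<^sub>i(M; E) = 0\<close> iff \<open>i + dim M < n\<close>.

  From \<open>K + t E = M + (1 + t) E\<close> one gets \<open>f\<^sub>r = \<Sum>m\<le>l. (l - r choose l - m) W\<^sub>m(M; E)\<close>. The claim is the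
  convexity of \<open>a \<mapsto> (a choose p)\<close>, which is affine for \<open>p \<le> 1\<close> and strictly convex for \<open>p = 2\<close>: equality
  forces \<open>W\<^sub>l\<^sub>-\<^sub>2(M; E) = 0\<close>, and then \<open>W\<^sub>m(M; E) = 0\<close> for all \<open>m \<le> l - 2\<close>.
\<close>

section \<open>Binomial coefficients\<close>

text \<open>The sum is the \<open>a\<close>-fold backward difference at \<open>b\<close> of the
  function sending x to x choose \<open>c\<close>. By Pascal's rule each difference lowers both
  entries by one. The induction splits \<open>Suc a choose Suc q\<close> accordingly, into the sums
  for \<open>a\<close> at \<open>b\<close> and at \<open>b - 1\<close>.\<close>

lemma alternating_binomial_convolution:
  assumes "a \<le> b"
  shows "(\<Sum>q\<le>a. (-1) ^ q * real (a choose q) * real ((b - q) choose c))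
    = (if a \<le> c then real ((b - a) choose (c - a)) else 0)"
  using assms
proof (induction a arbitrary: b)
  case 0
  then show ?case by simp
next
  case (Suc a)
  then obtain b' where b: "b = Suc b'" by (cases b) auto
  have ab: "a \<le> b'" using Suc.prems b by simp
  have "(\<Sum>q\<le>Suc a. (-1) ^ q * real (Suc a choose q) * real ((b - q) choose c))
      = real (b choose c) + (\<Sum>q\<le>a. (-1) ^ Suc q * real (Suc a choose Suc q) * real ((b' - q) choose c))"
    by (subst sum.atMost_Suc_shift) (simp add: b)
  also have "\<dots> = real (b choose c) + (\<Sum>q\<le>a. (-1) ^ Suc q * real (a choose Suc q) * real ((b' - q) choose c))
      - (\<Sum>q\<le>a. (-1) ^ q * real (a choose q) * real ((b' - q) choose c))"
    by (simp add: algebra_simps sum.distrib sum_negf sum_subtractf)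
  also have "real (b choose c) + (\<Sum>q\<le>a. (-1) ^ Suc q * real (a choose Suc q) * real ((b' - q) choose c))
      = (\<Sum>q\<le>Suc a. (-1) ^ q * real (a choose q) * real ((b - q) choose c))"
    by (subst sum.atMost_Suc_shift) (simp add: b)
  also have "\<dots> = (\<Sum>q\<le>a. (-1) ^ q * real (a choose q) * real ((b - q) choose c))"
    by simp
  also have "\<dots> = (if a \<le> c then real ((b - a) choose (c - a)) else 0)"
    using Suc.IH[of b] Suc.prems by simp
  also have "(\<Sum>q\<le>a. (-1) ^ q * real (a choose q) * real ((b' - q) choose c))
      = (if a \<le> c then real ((b' - a) choose (c - a)) else 0)"
    using Suc.IH[OF ab] .
  also have "(if a \<le> c then real ((b - a) choose (c - a)) else 0)
      - (if a \<le> c then real ((b' - a) choose (c - a)) else 0)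
      = (if Suc a \<le> c then real ((b - Suc a) choose (c - Suc a)) else 0)"
  proof (cases "Suc a \<le> c")
    case True
    then obtain d where d: "c - a = Suc d" "c - Suc a = d" by (metis Suc_diff_Suc Suc_le_eq)
    have "b - a = Suc (b' - a)" using ab b by simp
    then show ?thesis using True d b by simp
  next
    case False
    then show ?thesis by (cases "a = c") auto
  qed
  finally show ?case .
qed

text \<open>A unit step from x raises x choose \<open>Suc p\<close> by x choose \<open>p\<close>,
  and this increment is smallest at the left end \<open>b\<close>.\<close>

lemma binomial_increment_ge:
  "real d * real (b choose p) \<le> real ((b + d) choose Suc p) - real (b choose Suc p)"
proof (induction d)
  case (Suc d)
  have "b choose p \<le> (b + d) choose p" by (intro binomial_right_mono) auto
  then have "real (b choose p) \<le> real ((b + d) choose p)" by (rule of_nat_mono)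
  with Suc show ?case by (simp add: algebra_simps)
qed simp

text \<open>The same unit steps, now bounded by the increment at the right end
  \<open>a + d\<close>.\<close>

lemma binomial_increment_le:
  "real ((a + d) choose Suc p) - real (a choose Suc p) \<le> real d * real ((a + d) choose p)"
proof (induction d)
  case (Suc d)
  have "(a + d) choose p \<le> (a + Suc d) choose p" by (intro binomial_right_mono) auto
  then have le: "real ((a + d) choose p) \<le> real ((a + Suc d) choose p)" by (rule of_nat_mono)
  have "real d * real ((a + d) choose p) \<le> real d * real ((a + Suc d) choose p)"
    using le by (intro mult_left_mono) auto
  with Suc le show ?case by (simp add: algebra_simps)
qed simp

text \<open>For \<open>p = Suc q\<close>, the number \<open>b choose q\<close> separates the slope
  over [a, b] from the slope over [b, c]. The statement is cleared of denominators, so that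
  coinciding points are allowed.\<close>

lemma binomial_upper_convex:
  fixes a b c p :: nat
  assumes "a \<le> b" "b \<le> c"
  shows "(real c - real a) * real (b choose p)
    \<le> (real b - real a) * real (c choose p) + (real c - real b) * real (a choose p)"
proof (cases p)
  case (Suc q)
  obtain d e where d: "b = a + d" and e: "c = b + e" using assms by (auto simp: le_iff_add)
  have "real d * (real e * real (b choose q)) \<le> real d * (real (c choose p) - real (b choose p))"
    using binomial_increment_ge[of e b q] unfolding Suc e by (intro mult_left_mono) auto
  moreover have "real e * (real (b choose p) - real (a choose p)) \<le> real e * (real d * real (b choose q))"
    using binomial_increment_le[of a d q] unfolding Suc d by (intro mult_left_mono) auto
  ultimately show ?thesis by (simp add: d e algebra_simps)
qed (simp add: algebra_simps)

text \<open>The convexity defect of the quadratic x (x - 1) / 2 is computed exactly; it is half the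
  product of the three differences. This single strict case decides the equality case of the
  theorem.\<close>

lemma binomial_2_upper_strictly_convex:
  fixes a b c :: nat
  assumes "a < b" "b < c"
  shows "(real c - real a) * real (b choose 2)
    < (real b - real a) * real (c choose 2) + (real c - real b) * real (a choose 2)"
proof -
  have two: "real (x choose 2) = real x * (real x - 1) / 2" for x
    by (induction x) (simp_all add: numeral_2_eq_2 field_simps)
  have "(real b - real a) * real (c choose 2) + (real c - real b) * real (a choose 2)
      - (real c - real a) * real (b choose 2) = (real b - real a) * (real c - real a) * (real c - real b) / 2"
    unfolding two by (simp add: field_simps)
  moreover have "\<dots> > 0" using assms by simp
  ultimately show ?thesis by linarith
qed

section \<open>Determinants of definite pencils\<close>

text \<open>Along the line \<open>x + s *\<^sub>R v\<close> the form is affine in \<open>s\<close>,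
  because \<open>Q v v = 0\<close>. A nonzero slope \<open>2 * Q v x\<close> would make it negative
  somewhere.\<close>

lemma psd_form_null_vector:
  fixes Q :: "'a::real_vector \<Rightarrow> 'a \<Rightarrow> real"
  assumes S: "subspace S"
    and add: "\<And>x y z. Q (x + y) z = Q x z + Q y z" and scale: "\<And>c x z. Q (c *\<^sub>R x) z = c * Q x z"
    and sym: "\<And>x y. Q x y = Q y x" and nonneg: "\<And>x. x \<in> S \<Longrightarrow> 0 \<le> Q x x"
    and v: "v \<in> S" "Q v v = 0" and x: "x \<in> S"
  shows "Q v x = 0"
proof (rule ccontr)
  assume "Q v x \<noteq> 0"
  \<comment> \<open>Chosen so that the form takes the value -1 at
    \<open>x + s *\<^sub>R v\<close>.\<close>
  define s where "s = - (Q x x + 1) / (2 * Q v x)"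
  have "0 \<le> Q (x + s *\<^sub>R v) (x + s *\<^sub>R v)"
    using S v x by (intro nonneg) (auto intro: subspace_add subspace_scale)
  also have "\<dots> = Q x x + 2 * s * Q v x + s * s * Q v v"
    using sym[of x "x + s *\<^sub>R v"] sym[of v "x + s *\<^sub>R v"] sym[of x v]
    by (simp add: add scale algebra_simps)
  also have "\<dots> = - 1"
    using \<open>Q v x \<noteq> 0\<close> v by (simp add: s_def field_simps)
  finally show False by simp
qed

text \<open>The spectral theorem for \<open>A\<close> relative to the inner product defined by
  \<open>B\<close>. Eigenvectors are added one at a time: with \<open>l\<close> the maximal Rayleigh
  quotient on the complement \<open>S\<close>, the form \<open>l B - A\<close> is nonnegative on
  \<open>S\<close> and vanishes at the maximizer, which is therefore a null vector.\<close>

lemma simultaneous_diagonalization: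
  fixes A B :: "real^'n \<Rightarrow> real^'n"
  assumes linA: "linear A" and linB: "linear B"
    and symA: "\<And>x y. A x \<bullet> y = A y \<bullet> x" and symB: "\<And>x y. B x \<bullet> y = B y \<bullet> x"
    and posB: "\<And>x. x \<noteq> 0 \<Longrightarrow> 0 < B x \<bullet> x"
  obtains v :: "'n \<Rightarrow> real^'n" and L :: "'n \<Rightarrow> real"
  where "\<And>a b. B (v a) \<bullet> v b = (if a = b then 1 else 0)" "\<And>a. A (v a) = L a *\<^sub>R B (v a)"
proof -
  have "\<exists>v L. (\<forall>a\<in>I. \<forall>b\<in>I. B (v a) \<bullet> v b = (if a = b then 1 else 0)) \<and>
      (\<forall>a\<in>I. A (v a) = L a *\<^sub>R B (v a))" for I :: "'n set"
  proof (induction I rule: finite_induct[OF finite])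
    case (2 k I)
    then obtain v L where ortho: "\<And>a b. a \<in> I \<Longrightarrow> b \<in> I \<Longrightarrow> B (v a) \<bullet> v b = (if a = b then 1 else 0)"
      and eig: "\<And>a. a \<in> I \<Longrightarrow> A (v a) = L a *\<^sub>R B (v a)" by metis
    define S where "S = {x. \<forall>a\<in>I. B (v a) \<bullet> x = 0}"
    have subS: "subspace S"
      unfolding S_def by (auto simp: subspace_def inner_add_right)
    have "card I < card (insert k I)" using 2 by simp
    also have "\<dots> \<le> CARD('n)" by (intro card_mono) auto
    finally have "card I < CARD('n)" .
    moreover have "dim ((\<lambda>a. B (v a)) ` I) \<le> card I"
      by (meson card_image_le dim_le_card' finite finite_imageI le_trans)
    ultimately have "dim ((\<lambda>a. B (v a)) ` I) < DIM(real^'n)" by simp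
    \<comment> \<open>Fewer than \<open>CARD('n)\<close> vectors have been found, so
      \<open>S\<close> contains a nonzero vector and the unit sphere of \<open>S\<close> is
      nonempty.\<close>
    then obtain w where w: "w \<noteq> 0" "\<And>y. y \<in> span ((\<lambda>a. B (v a)) ` I) \<Longrightarrow> orthogonal w y"
      using orthogonal_to_subspace_exists by blast
    have wS: "w \<in> S"
      unfolding S_def using w(2) by (auto simp: orthogonal_def inner_commute[of _ w] intro: span_base)
    have contA: "continuous_on X A" and contB: "continuous_on X B" for X
      using linA linB by (auto intro: linear_continuous_on simp: linear_linear)
    \<comment> \<open>The next eigenvector maximizes the Rayleigh quotient on the \<open>B\<close>-orthogonal complement of the previous ones.\<close>
    define T where "T = S \<inter> sphere 0 1"
    have "compact T" unfolding T_def
      using closed_subspace[OF subS] by (simp add: closed_Int_compact)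
    moreover have "(1 / norm w) *\<^sub>R w \<in> T"
      unfolding T_def using wS w(1) subS by (auto simp: subspace_scale)
    moreover have "continuous_on T (\<lambda>x. (A x \<bullet> x) / (B x \<bullet> x))"
    proof (intro continuous_intros contA contB ballI)
      fix x assume "x \<in> T"
      then have "x \<noteq> 0" unfolding T_def by auto
      then show "B x \<bullet> x \<noteq> 0" using posB by fastforce
    qed
    ultimately have "\<exists>u\<in>T. \<forall>x\<in>T. (A x \<bullet> x) / (B x \<bullet> x) \<le> (A u \<bullet> u) / (B u \<bullet> u)"
      by (intro continuous_attains_sup) auto
    then obtain u where u: "u \<in> T" "\<And>x. x \<in> T \<Longrightarrow> (A x \<bullet> x) / (B x \<bullet> x) \<le> (A u \<bullet> u) / (B u \<bullet> u)"
      by blast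
    have "u \<noteq> 0" using u(1) unfolding T_def by auto
    then have Bu: "0 < B u \<bullet> u" by (rule posB)
    define l where "l = (A u \<bullet> u) / (B u \<bullet> u)"
    define Q where "Q x y = l * (B x \<bullet> y) - A x \<bullet> y" for x y
    have Qnonneg: "0 \<le> Q x x" if "x \<in> S" for x
    proof (cases "x = 0")
      case True
      then show ?thesis using linA linB by (simp add: Q_def linear_0)
    next
      case False
      define x' where "x' = (1 / norm x) *\<^sub>R x"
      have "x' \<in> T" unfolding T_def x'_def using that False subS by (auto simp: subspace_scale)
      then have "(A x' \<bullet> x') / (B x' \<bullet> x') \<le> l" using u(2) unfolding l_def by blast
      also have "(A x' \<bullet> x') / (B x' \<bullet> x') = (A x \<bullet> x) / (B x \<bullet> x)"
        using False linA linB by (simp add: x'_def linear_cmul)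
      finally show ?thesis using posB[OF False] by (simp add: Q_def field_simps)
    qed
    have Qadd: "Q (x + y) z = Q x z + Q y z" for x y z
      using linA linB by (simp add: Q_def linear_add inner_add_left algebra_simps)
    have Qscale: "Q (c *\<^sub>R x) z = c * Q x z" for c x z
      using linA linB by (simp add: Q_def linear_cmul algebra_simps)
    have Qsym: "Q x y = Q y x" for x y using symA symB by (simp add: Q_def)
    have uS: "u \<in> S" using u(1) by (simp add: T_def)
    have Quu: "Q u u = 0" using Bu by (simp add: Q_def l_def)
    have QS: "Q u x = 0" if "x \<in> S" for x
      by (rule psd_form_null_vector[where Q = Q and S = S]) (use subS Qadd Qscale Qsym Qnonneg uS Quu that in auto)
    have Qv: "Q u (v a) = 0" if "a \<in> I" for a
    proof -
      have "B (v a) \<bullet> u = 0" using uS that by (simp add: S_def)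
      then show ?thesis using eig[OF that] unfolding Qsym[of u] by (simp add: Q_def)
    qed
    \<comment> \<open>Every \<open>x\<close> splits into its \<open>B\<close>-orthogonal projection
      to the earlier eigenvectors and a remainder in \<open>S\<close>; the functional
      \<open>Q u\<close> vanishes on both.\<close>
    have Quall: "Q u x = 0" for x
    proof -
      define y where "y = x - (\<Sum>a\<in>I. (B (v a) \<bullet> x) *\<^sub>R v a)"
      have "B (v b) \<bullet> y = 0" if "b \<in> I" for b
      proof -
        have "B (v b) \<bullet> (\<Sum>a\<in>I. (B (v a) \<bullet> x) *\<^sub>R v a) = (\<Sum>a\<in>I. if b = a then B (v a) \<bullet> x else 0)"
          unfolding inner_sum_right using ortho that by (intro sum.cong) auto
        then show ?thesis using that by (simp add: y_def inner_diff_right)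
      qed
      then have "y \<in> S" by (simp add: S_def)
      have Qsum: "Q u (\<Sum>a\<in>I. r a *\<^sub>R v a) = 0" for r
      proof -
        have "Q u (\<Sum>a\<in>I. r a *\<^sub>R v a) = (\<Sum>a\<in>I. r a * Q u (v a))"
          by (simp add: Q_def inner_sum_right sum_distrib_left sum_subtractf right_diff_distrib mult.left_commute)
        then show ?thesis using Qv by simp
      qed
      have "Q u x = Q u y + Q u (\<Sum>a\<in>I. (B (v a) \<bullet> x) *\<^sub>R v a)"
        by (simp add: Q_def y_def inner_diff_right algebra_simps)
      then show ?thesis using QS[OF \<open>y \<in> S\<close>] Qsum by simp
    qed
    have "(l *\<^sub>R B u - A u) \<bullet> x = 0" for x
      using Quall[of x] by (simp add: Q_def inner_diff_left)
    then have eigu: "A u = l *\<^sub>R B u"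
      by (metis eq_iff_diff_eq_0 inner_eq_zero_iff)
    define u' where "u' = (1 / sqrt (B u \<bullet> u)) *\<^sub>R u"
    have u'1: "B u' \<bullet> u' = 1" using Bu linB by (simp add: u'_def linear_cmul)
    have u'2: "A u' = l *\<^sub>R B u'" using linA linB eigu by (simp add: u'_def linear_cmul)
    have u'3: "B (v a) \<bullet> u' = 0" if "a \<in> I" for a using uS that by (simp add: S_def u'_def)
    have u'4: "B u' \<bullet> v a = 0" if "a \<in> I" for a using u'3[OF that] symB by metis
    show ?case
    proof (intro exI[of _ "v(k := u')"] exI[of _ "L(k := l)"] conjI ballI)
      fix a b assume "a \<in> insert k I" "b \<in> insert k I"
      then show "B ((v(k := u')) a) \<bullet> (v(k := u')) b = (if a = b then 1 else 0)"
        using 2(2) ortho u'1 u'3 u'4 by auto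
    next
      fix a assume "a \<in> insert k I"
      then show "A ((v(k := u')) a) = (L(k := l)) a *\<^sub>R B ((v(k := u')) a)"
        using 2(2) eig u'2 by auto
    qed
  qed auto
  from this[of UNIV] show ?thesis using that by auto
qed

text \<open>The coefficients are the elementary symmetric polynomials: \<open>X\<close> collects the
  factors contributing \<open>L\<close>, and its complement, of size \<open>i\<close>, those
  contributing \<open>t\<close>.\<close>

lemma prod_linear_expansion:
  fixes L :: "'n::finite \<Rightarrow> real"
  shows "(\<Prod>a\<in>UNIV. L a + t) = (\<Sum>i\<le>CARD('n). (\<Sum>X | card X + i = CARD('n). prod L X) * t ^ i)"
proof -
  have "(\<Prod>a\<in>UNIV. L a + t) = (\<Sum>X\<in>UNIV. prod L X * t ^ card (- X))"
    by (subst prod_add) (simp_all add: Compl_eq_Diff_UNIV)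
  also have "\<dots> = (\<Sum>i\<le>CARD('n). \<Sum>X | X \<in> UNIV \<and> card (- X) = i. prod L X * t ^ card (- X))"
    by (rule sum.group[symmetric]) (auto simp: card_mono)
  also have "\<dots> = (\<Sum>i\<le>CARD('n). (\<Sum>X | card X + i = CARD('n). prod L X) * t ^ i)"
  proof (intro sum.cong refl)
    fix i assume "i \<in> {..CARD('n)}"
    have "card X + i = CARD('n) \<longleftrightarrow> card (- X) = i" for X :: "'n set"
      using card_Diff_subset[of X UNIV] card_mono[of UNIV X] by (auto simp: Compl_eq_Diff_UNIV)
    then show "(\<Sum>X | X \<in> UNIV \<and> card (- X) = i. prod L X * t ^ card (- X))
        = (\<Sum>X | card X + i = CARD('n). prod L X) * t ^ i"
      by (simp add: sum_distrib_right)
  qed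
  finally show ?thesis .
qed

text \<open>In a basis diagonalizing both forms, the determinant is a positive multiple of the
  product of the \<open>L a + t\<close> with all \<open>L a\<close> nonnegative. The coefficient of
  \<open>t ^ i\<close> is then nonzero iff at least \<open>CARD('n) - i\<close> of the
  \<open>L a\<close> are nonzero, and the number of zeros among them is the dimension of the null
  space of \<open>A\<close>.\<close>

lemma det_pencil:
  fixes A B :: "real^'n \<Rightarrow> real^'n"
  assumes linA: "linear A" and linB: "linear B"
    and symA: "\<And>x y. A x \<bullet> y = A y \<bullet> x" and symB: "\<And>x y. B x \<bullet> y = B y \<bullet> x"
    and psdA: "\<And>x. 0 \<le> A x \<bullet> x" and posB: "\<And>x. x \<noteq> 0 \<Longrightarrow> 0 < B x \<bullet> x"
  obtains c :: "nat \<Rightarrow> real"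
  where "\<And>t. det (matrix (\<lambda>x. A x + t *\<^sub>R B x)) = (\<Sum>i\<le>CARD('n). c i * t ^ i)"
    "\<And>i. 0 \<le> c i" "\<And>i. i \<le> CARD('n) \<Longrightarrow> c i = 0 \<longleftrightarrow> i < dim {x. A x \<bullet> x = 0}"
proof -
  obtain v :: "'n \<Rightarrow> real^'n" and L where v: "\<And>a b. B (v a) \<bullet> v b = (if a = b then 1 else 0)" "\<And>a. A (v a) = L a *\<^sub>R B (v a)"
    using simultaneous_diagonalization[OF linA linB symA symB posB] by blast
  have Lnonneg: "0 \<le> L a" for a using psdA[of "v a"] v by simp
  \<comment> \<open>The columns of \<open>P\<close> are the common eigenvectors, so conjugation by
    \<open>P\<close> yields the matrix of a form in that basis.\<close>
  define P :: "real^'n^'n" where "P = (\<chi> i j. v j $ i)"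
  have Pcol: "P *v axis b 1 = v b" for b
    by (simp add: P_def matrix_vector_mul_component vec_eq_iff matrix_vector_mult_def axis_def
        if_distrib cong: if_cong)
  have entry: "(transpose P ** matrix F ** P) $ a $ b = v a \<bullet> F (v b)" if "linear F" for F a b
  proof -
    have "(transpose P ** matrix F ** P) $ a $ b
        = axis a 1 \<bullet> ((transpose P ** matrix F ** P) *v axis b 1)"
      by (simp add: inner_axis' matrix_vector_mult_basis column_def)
    also have "\<dots> = (P *v axis a 1) \<bullet> (matrix F *v (P *v axis b 1))"
      by (simp add: matrix_vector_mul_assoc[symmetric] dot_lmul_matrix[symmetric] vector_transpose_matrix
          flip: transpose_matrix_vector)
    finally show ?thesis by (simp add: Pcol matrix_vector_mul that)
  qed
  have linAB: "linear (\<lambda>x. A x + t *\<^sub>R B x)" for t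
    using linA linB by (auto simp: linear_iff algebra_simps)
  have diag: "det P * det P * det (matrix (\<lambda>x. A x + t *\<^sub>R B x)) = (\<Prod>a\<in>UNIV. L a + t)" for t
  proof -
    have e: "(transpose P ** matrix (\<lambda>x. A x + t *\<^sub>R B x) ** P) $ a $ b = (if a = b then L a + t else 0)" for a b
      using v(1)[of b a] by (auto simp: entry[OF linAB] v(2) inner_add_right inner_commute)
    have "det (transpose P ** matrix (\<lambda>x. A x + t *\<^sub>R B x) ** P) = (\<Prod>a\<in>UNIV. L a + t)"
      by (subst det_diagonal) (simp_all add: e)
    then show ?thesis by (simp add: det_mul ac_simps)
  qed
  have eB: "(transpose P ** matrix B ** P) $ a $ b = (if a = b then 1 else 0)" for a b
      using v(1)[of b a] by (auto simp: entry[OF linB] inner_commute)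
  \<comment> \<open>For \<open>B\<close> the congruent matrix is the identity, which forces
    \<open>det P\<close> to be nonzero.\<close>
  have "det (transpose P ** matrix B ** P) = (\<Prod>a\<in>(UNIV::'n set). 1)"
    by (subst det_diagonal) (simp_all add: eB)
  then have detP: "det P \<noteq> 0" by (auto simp: det_mul)
  then have invP: "invertible P" by (simp add: invertible_det_nz)
  define Z where "Z = {a. L a = 0}"
  have form: "A (P *v y) \<bullet> (P *v y) = (\<Sum>a\<in>UNIV. L a * (y $ a)\<^sup>2)" for y
  proof -
    have Py: "P *v y = (\<Sum>a\<in>UNIV. (y $ a) *\<^sub>R v a)"
      by (simp add: vec_eq_iff P_def matrix_vector_mult_def mult.commute)
    have "A (P *v y) \<bullet> (P *v y) = (\<Sum>a\<in>UNIV. \<Sum>b\<in>UNIV. y $ a * (y $ b * (A (v b) \<bullet> v a)))"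
      unfolding Py using linA
      by (simp add: linear_sum linear_cmul inner_sum_left inner_sum_right sum_distrib_left)
    also have "\<dots> = (\<Sum>a\<in>UNIV. \<Sum>b\<in>UNIV. if a = b then L a * (y $ a)\<^sup>2 else 0)"
      by (intro sum.cong refl) (auto simp: v power2_eq_square)
    finally show ?thesis by simp
  qed
  \<comment> \<open>The form is a sum of squares weighted by \<open>L a\<close>, so its zeros are
    exactly the vectors supported on the coordinates in \<open>Z\<close>.\<close>
  have "{x. A x \<bullet> x = 0} = (*v) P ` {y. \<forall>a. a \<notin> Z \<longrightarrow> y $ a = 0}"
  proof -
    have *: "A (P *v y) \<bullet> (P *v y) = 0 \<longleftrightarrow> (\<forall>a. a \<notin> Z \<longrightarrow> y $ a = 0)" for y
      unfolding form by (subst sum_nonneg_eq_0_iff) (auto simp: Lnonneg Z_def)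
    have surjP: "range ((*v) P) = UNIV"
      using invP matrix_right_invertible_surjective[of P] by (auto simp: invertible_def)
    have "{x. A x \<bullet> x = 0} = (*v) P ` {y. A (P *v y) \<bullet> (P *v y) = 0}"
      using surjP by (auto simp: image_iff)
    then show ?thesis unfolding * .
  qed
  then have "dim {x. A x \<bullet> x = 0} = dim {y::real^'n. \<forall>a. a \<notin> Z \<longrightarrow> y $ a = 0}"
    using inj_matrix_vector_mult[OF invP] by (simp add: dim_image_eq inj_on_subset)
  then have dimZ: "dim {x. A x \<bullet> x = 0} = card Z"
    using dim_substandard_cart[of Z, where ?'a = real] by (simp add: dim_vec_eq)
  define c where "c i = (\<Sum>X | card X + i = CARD('n). prod L X) / (det P * det P)" for i
  show ?thesis
  proof
    show "det (matrix (\<lambda>x. A x + t *\<^sub>R B x)) = (\<Sum>i\<le>CARD('n). c i * t ^ i)" for t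
    proof -
      have "det (matrix (\<lambda>x. A x + t *\<^sub>R B x)) = (\<Prod>a\<in>UNIV. L a + t) / (det P * det P)"
        using diag[of t] detP by (simp add: field_simps)
      moreover have "(\<Sum>i\<le>CARD('n). s i * t ^ i) / r = (\<Sum>i\<le>CARD('n). s i / r * t ^ i)" for s r
        by (simp add: sum_divide_distrib)
      ultimately show ?thesis by (simp only: prod_linear_expansion c_def)
    qed
    show "0 \<le> c i" for i
      unfolding c_def by (intro divide_nonneg_nonneg sum_nonneg prod_nonneg ballI Lnonneg zero_le_square)
    fix i assume i: "i \<le> CARD('n)"
    have cZ: "card (- Z) + card Z = CARD('n)"
      using card_Diff_subset[of Z UNIV] card_mono[of UNIV Z] by (simp add: Compl_eq_Diff_UNIV)
    have "c i = 0 \<longleftrightarrow> (\<forall>X. card X + i = CARD('n) \<longrightarrow> \<not> X \<subseteq> - Z)"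
    proof -
      have "c i = 0 \<longleftrightarrow> (\<forall>X\<in>{X. card X + i = CARD('n)}. prod L X = 0)"
        unfolding c_def using detP
        by (subst divide_eq_0_iff, subst sum_nonneg_eq_0_iff) (auto intro: prod_nonneg Lnonneg)
      also have "\<dots> \<longleftrightarrow> (\<forall>X. card X + i = CARD('n) \<longrightarrow> \<not> X \<subseteq> - Z)"
      proof -
        have "prod L X = 0 \<longleftrightarrow> \<not> X \<subseteq> - Z" for X
          by (subst prod_zero_iff) (auto simp: Z_def)
        then show ?thesis by simp
      qed
      finally show ?thesis .
    qed
    \<comment> \<open>A set of \<open>CARD('n) - i\<close> indices avoiding \<open>Z\<close> exists
      iff the complement of \<open>Z\<close> is that large.\<close>
    also have "\<dots> \<longleftrightarrow> i < card Z"
    proof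
      assume *: "\<forall>X. card X + i = CARD('n) \<longrightarrow> \<not> X \<subseteq> - Z"
      show "i < card Z"
      proof (rule ccontr)
        assume "\<not> i < card Z"
        then have "CARD('n) - i \<le> card (- Z)" using cZ by simp
        then obtain X where "X \<subseteq> - Z" "card X = CARD('n) - i"
          by (meson obtain_subset_with_card_n)
        then show False using * i by auto
      qed
    next
      assume "i < card Z"
      show "\<forall>X. card X + i = CARD('n) \<longrightarrow> \<not> X \<subseteq> - Z"
      proof (intro allI impI notI)
        fix X assume "card X + i = CARD('n)" "X \<subseteq> - Z"
        then show False using cZ card_mono[of "- Z" X] \<open>i < card Z\<close> by simp
      qed
    qed
    finally show "c i = 0 \<longleftrightarrow> i < dim {x. A x \<bullet> x = 0}" by (simp add: dimZ)
  qed
qed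

section \<open>Convex potentials with prescribed gradient image\<close>

lemma exp_series_summable:
  fixes y :: "nat \<Rightarrow> 'a::real_inner" and u :: "nat \<Rightarrow> 'b::banach"
  assumes y: "\<And>k. norm (y k) \<le> R" and u: "summable (\<lambda>k. norm (u k))"
  shows "summable (\<lambda>k. exp (x \<bullet> y k) *\<^sub>R u k)"
proof (rule summable_norm_cancel, rule summable_comparison_test')
  show "summable (\<lambda>k. exp (norm x * R) * norm (u k))" using u by (rule summable_mult)
  fix k
  have "x \<bullet> y k \<le> norm x * norm (y k)" by (rule norm_cauchy_schwarz)
  also have "\<dots> \<le> norm x * R" using y by (intro mult_left_mono) auto
  finally show "norm (norm (exp (x \<bullet> y k) *\<^sub>R u k)) \<le> exp (norm x * R) * norm (u k)"
    by (simp add: mult_right_mono)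
qed

text \<open>Termwise differentiation: on a ball around 0 containing \<open>x\<close>, the
  differentiated terms are dominated by a constant multiple of \<open>norm h * norm (u k)\<close>,
  so their tails are uniformly small.\<close>

lemma exp_series_has_derivative:
  fixes y :: "nat \<Rightarrow> 'a::real_inner" and u :: "nat \<Rightarrow> 'b::banach"
  assumes y: "\<And>k. norm (y k) \<le> R" and u: "summable (\<lambda>k. norm (u k))"
  shows "((\<lambda>x. \<Sum>k. exp (x \<bullet> y k) *\<^sub>R u k) has_derivative
    (\<lambda>h. \<Sum>k. exp (x \<bullet> y k) *\<^sub>R ((h \<bullet> y k) *\<^sub>R u k))) (at x)"
proof -
  have R: "0 \<le> R" using y[of 0] norm_ge_zero order_trans by blast
  define r where "r = norm x + 1"
  define f' where "f' k x h = exp (x \<bullet> y k) *\<^sub>R ((h \<bullet> y k) *\<^sub>R u k)" for k x h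
  define C where "C = exp (r * R) * R"
  have C: "0 \<le> C" using R by (simp add: C_def)
  have f'le: "norm (f' k z h) \<le> C * norm h * norm (u k)" if z: "z \<in> ball 0 r" for k z h
  proof -
    have "z \<bullet> y k \<le> norm z * norm (y k)" by (rule norm_cauchy_schwarz)
    also have "\<dots> \<le> r * R" using y[of k] z by (intro mult_mono) (auto simp: r_def)
    finally have "exp (z \<bullet> y k) \<le> exp (r * R)" by simp
    moreover have "\<bar>h \<bullet> y k\<bar> \<le> norm h * R"
      by (rule order_trans[OF Cauchy_Schwarz_ineq2]) (use y in \<open>auto intro: mult_left_mono\<close>)
    ultimately have "exp (z \<bullet> y k) * \<bar>h \<bullet> y k\<bar> \<le> exp (r * R) * (norm h * R)"
      by (intro mult_mono) auto
    then have "exp (z \<bullet> y k) * \<bar>h \<bullet> y k\<bar> * norm (u k) \<le> exp (r * R) * (norm h * R) * norm (u k)"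
      by (intro mult_right_mono) auto
    then show ?thesis by (simp add: f'_def C_def mult_ac abs_mult)
  qed
  have f'sum: "summable (\<lambda>k. f' k z h)" if z: "z \<in> ball 0 r" for z h
    by (rule summable_norm_cancel, rule summable_comparison_test'[OF summable_mult[OF u]])
      (use f'le[OF z] in auto)
  have "\<exists>g. \<forall>x\<in>ball 0 r. (\<lambda>k. exp (x \<bullet> y k) *\<^sub>R u k) sums (g x) \<and>
      (g has_derivative (\<lambda>h. \<Sum>k. f' k x h)) (at x within ball 0 r)"
  proof (rule has_derivative_series)
    show "convex (ball (0::'a) r)" by (rule convex_ball)
    show "((\<lambda>x. exp (x \<bullet> y n) *\<^sub>R u n) has_derivative (\<lambda>h. f' n x h)) (at x within ball 0 r)" for n x
      unfolding f'_def by (auto intro!: derivative_eq_intros simp: algebra_simps)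
    show "x \<in> ball 0 r" by (simp add: r_def)
    show "(\<lambda>n. exp (x \<bullet> y n) *\<^sub>R u n) sums (\<Sum>k. exp (x \<bullet> y k) *\<^sub>R u k)"
      by (intro summable_sums exp_series_summable[OF y u])
    fix e :: real assume "e > 0"
    \<comment> \<open>The summand 1 keeps the denominator positive when \<open>C = 0\<close>, which
      happens for \<open>R = 0\<close>.\<close>
    then have "0 < e / (C + 1)" using C by simp
    then obtain n0 where n0: "\<And>n. n \<ge> n0 \<Longrightarrow> norm (\<Sum>i. norm (u (i + n))) < e / (C + 1)"
      using suminf_exist_split[OF _ u] by blast
    show "\<forall>\<^sub>F n in sequentially. \<forall>x\<in>ball 0 r. \<forall>h. norm ((\<Sum>i<n. f' i x h) - (\<Sum>k. f' k x h)) \<le> e * norm h"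
      unfolding eventually_sequentially
    proof (intro exI[of _ n0] allI impI ballI)
      fix n z h assume n: "n0 \<le> n" and z: "z \<in> ball (0::'a) r"
      have su: "summable (\<lambda>i. norm (u (i + n)))" using u by (subst summable_iff_shift)
      have "norm ((\<Sum>i<n. f' i z h) - (\<Sum>k. f' k z h)) = norm (\<Sum>i. f' (i + n) z h)"
        using suminf_split_initial_segment[OF f'sum[OF z, of h], of n]
        by (simp add: norm_minus_commute)
      also have "\<dots> \<le> (\<Sum>i. norm (f' (i + n) z h))"
        by (rule summable_norm, rule summable_comparison_test'[OF summable_mult[OF su]])
          (use f'le[OF z] in auto)
      also have "\<dots> \<le> (\<Sum>i. C * norm h * norm (u (i + n)))"
        by (rule suminf_le, rule f'le[OF z], rule summable_comparison_test'[OF summable_mult[OF su]])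
          (use f'le[OF z] in \<open>auto intro: summable_mult su\<close>)
      also have "\<dots> = C * norm h * (\<Sum>i. norm (u (i + n)))"
        by (rule suminf_mult[OF su])
      also have "\<dots> \<le> C * norm h * (e / (C + 1))"
        using n0[OF n] C by (intro mult_left_mono) auto
      also have "\<dots> = (C / (C + 1)) * (e * norm h)" by simp
      also have "\<dots> \<le> 1 * (e * norm h)"
        using C \<open>e > 0\<close> by (intro mult_right_mono) auto
      finally show "norm ((\<Sum>i<n. f' i z h) - (\<Sum>k. f' k z h)) \<le> e * norm h" by simp
    qed
  qed
  then obtain g where g: "\<And>x. x \<in> ball 0 r \<Longrightarrow> (\<lambda>k. exp (x \<bullet> y k) *\<^sub>R u k) sums (g x)"
    "\<And>x. x \<in> ball 0 r \<Longrightarrow> (g has_derivative (\<lambda>h. \<Sum>k. f' k x h)) (at x within ball 0 r)" by blast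
  have x: "x \<in> ball 0 r" by (simp add: r_def)
  have "(g has_derivative (\<lambda>h. \<Sum>k. f' k x h)) (at x)"
    using g(2)[OF x] at_within_open[OF x open_ball] by simp
  then show ?thesis
    unfolding f'_def[symmetric]
    by (rule has_derivative_transform_within_open[OF _ open_ball x]) (use g(1) sums_unique in blast)
qed

lemma dense_sequence:
  fixes M :: "'a::{metric_space, second_countable_topology} set"
  assumes "M \<noteq> {}"
  obtains y :: "nat \<Rightarrow> 'a" where "range y \<subseteq> M" "M \<subseteq> closure (range y)"
proof -
  obtain T where T: "countable T" "T \<subseteq> M" "M \<subseteq> closure T" using separable .
  then have "T \<noteq> {}" using assms by auto
  then show ?thesis using that[of "from_nat_into T"] T by (simp add: range_from_nat_into)
qed

text \<open>A smooth substitute \<phi> for the support function of \<open>M\<close>, with gradient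
  \<open>g\<close> and Hessian \<open>g'\<close>. The last clause bounds the support function by
  \<phi> up to a constant and an arbitrarily small linear term.\<close>

definition body_potential ::
    "'a::euclidean_space set \<Rightarrow> ('a \<Rightarrow> real) \<Rightarrow> ('a \<Rightarrow> 'a) \<Rightarrow> ('a \<Rightarrow> 'a \<Rightarrow> 'a) \<Rightarrow> bool" where
  "body_potential M \<phi> g g' \<longleftrightarrow>
    (\<forall>x. (\<phi> has_derivative (\<lambda>h. g x \<bullet> h)) (at x)) \<and>
    (\<forall>x. (g has_derivative g' x) (at x)) \<and>
    (\<forall>x. g x \<in> M) \<and>
    (\<forall>x h w. g' x h \<bullet> w = g' x w \<bullet> h) \<and>
    (\<forall>x h. 0 \<le> g' x h \<bullet> h) \<and>
    (\<forall>x h. g' x h \<bullet> h = 0 \<longleftrightarrow> (\<forall>a\<in>M. \<forall>b\<in>M. h \<bullet> a = h \<bullet> b)) \<and>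
    (\<forall>\<delta>>0. \<exists>C. \<forall>x. \<forall>a\<in>M. x \<bullet> a \<le> \<phi> x + C + \<delta> * norm x)"

text \<open>The potential is the logarithm of the Laplace transform of the measure with masses
  \<open>(1/2) ^ k\<close> at a dense sequence \<open>y k\<close>. Its gradient is the mean of the
  exponentially tilted measure and its Hessian the covariance, so a direction is null iff it is
  constant on the \<open>y k\<close>, hence on \<open>M\<close>.\<close>

proposition body_potential_exists:
  fixes M :: "'a::euclidean_space set"
  assumes ne: "M \<noteq> {}" and comp: "compact M" and conv: "convex M"
  shows "\<exists>\<phi> g g'. body_potential M \<phi> g g'"
proof -
  obtain y :: "nat \<Rightarrow> 'a" where yM: "range y \<subseteq> M" and dense: "M \<subseteq> closure (range y)"
    using dense_sequence[OF ne] .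
  have yM': "y k \<in> M" for k using yM by auto
  obtain R where R: "\<And>a. a \<in> M \<Longrightarrow> norm a \<le> R"
    using compact_imp_bounded[OF comp] by (auto simp: bounded_iff)
  have yR: "norm (y k) \<le> R" for k using R yM' by auto
  have R0: "0 \<le> R" using yR[of 0] norm_ge_zero order_trans by blast
  define c :: "nat \<Rightarrow> real" where "c k = (1/2) ^ k" for k
  have csum: "summable (\<lambda>k. norm (c k))"
    unfolding c_def by (simp add: summable_geometric)
  \<comment> \<open>\<open>q x\<close> are the tilted weights; \<open>Z\<close> and \<open>N\<close>
    below are their total mass and first moment.\<close>
  define q where "q x k = exp (x \<bullet> y k) * c k" for x k
  have q_eq: "q = (\<lambda>x k. exp (x \<bullet> y k) * c k)" by (intro ext) (rule q_def)
  have qpos: "0 < q x k" for x k by (simp add: q_def c_def)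
  have cu: "summable (\<lambda>k. norm (c k *\<^sub>R v k))" if "\<And>k. norm (v k) \<le> B" for v :: "nat \<Rightarrow> 'b::real_normed_vector" and B
    by (rule summable_comparison_test'[OF summable_mult[OF csum, of B]])
      (use that in \<open>auto simp: mult.commute[of B] intro: mult_left_mono\<close>)
  have qv: "summable (\<lambda>k. q x k *\<^sub>R v k)" if "\<And>k. norm (v k) \<le> B" for v :: "nat \<Rightarrow> 'b::banach" and B x
    using exp_series_summable[OF yR cu[OF that], of x] by (simp add: q_def)
  have qr: "summable (\<lambda>k. q x k * s k)" if "\<And>k. \<bar>s k\<bar> \<le> B" for s B x
    using qv[of s B x] that by simp
  have iy: "\<bar>h \<bullet> y k\<bar> \<le> norm h * R" for h k
    by (rule order_trans[OF Cauchy_Schwarz_ineq2]) (use yR in \<open>auto intro: mult_left_mono\<close>)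
  define Z where "Z x = (\<Sum>k. q x k)" for x
  define N where "N x = (\<Sum>k. q x k *\<^sub>R y k)" for x
  have qsum: "summable (q x)" for x using qr[of "\<lambda>_. 1" 1 x] by simp
  have Zpos: "0 < Z x" for x
    unfolding Z_def using qsum qpos by (rule suminf_pos)
  have inner_N: "(\<Sum>k. q x k * (h \<bullet> y k)) = h \<bullet> N x" for x h
    unfolding N_def using bounded_linear.suminf[OF bounded_linear_inner_right qv[OF yR, of x], of h] by simp
  have derZ: "(Z has_derivative (\<lambda>h. h \<bullet> N x)) (at x)" for x
  proof -
    have "(\<Sum>k. exp (x \<bullet> y k) *\<^sub>R ((h \<bullet> y k) *\<^sub>R c k)) = h \<bullet> N x" for h
      unfolding inner_N[symmetric] by (simp add: q_def mult_ac)
    then show ?thesis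
      using exp_series_has_derivative[where y = y and u = c and x = x, OF yR csum]
      by (simp add: Z_def[abs_def] q_eq)
  qed
  define dN where "dN x h = (\<Sum>k. (q x k * (h \<bullet> y k)) *\<^sub>R y k)" for x h
  have derN: "(N has_derivative dN x) (at x)" for x
  proof -
    have "(\<lambda>h. \<Sum>k. exp (x \<bullet> y k) *\<^sub>R ((h \<bullet> y k) *\<^sub>R (c k *\<^sub>R y k))) = dN x"
      by (simp add: dN_def[abs_def] q_def mult_ac)
    then show ?thesis
      using exp_series_has_derivative[where y = y and u = "\<lambda>k. c k *\<^sub>R y k" and x = x, OF yR cu[OF yR]]
      by (simp add: N_def[abs_def] q_eq)
  qed
  define g where "g x = inverse (Z x) *\<^sub>R N x" for x
  define g' where "g' x h = inverse (Z x) *\<^sub>R dN x h - (inverse (Z x) * (h \<bullet> N x) * inverse (Z x)) *\<^sub>R N x" for x h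
  have derg: "(g has_derivative g' x) (at x)" for x
    unfolding g_def[abs_def] g'_def[abs_def] using Zpos[of x]
    by (auto intro!: derivative_eq_intros derZ derN simp: algebra_simps)
  have inner_dN: "dN x h \<bullet> w = (\<Sum>k. q x k * ((h \<bullet> y k) * (w \<bullet> y k)))" for x h w
  proof -
    have "summable (\<lambda>k. q x k *\<^sub>R ((h \<bullet> y k) *\<^sub>R y k))"
      by (rule qv[of _ "norm h * R * R"]) (use iy yR R0 in \<open>auto intro!: mult_mono\<close>)
    then show ?thesis
      unfolding dN_def using bounded_linear.suminf[OF bounded_linear_inner_left, of "\<lambda>k. (q x k * (h \<bullet> y k)) *\<^sub>R y k" w]
      by (simp add: inner_commute mult_ac)
  qed
  \<comment> \<open>The covariance formula, centred at the mean \<open>g x\<close>; it exhibits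
    symmetry and nonnegativity at once.\<close>
  have form: "g' x h \<bullet> w = inverse (Z x) * (\<Sum>k. q x k * ((h \<bullet> (y k - g x)) * (w \<bullet> (y k - g x))))" for x h w
  proof -
    have s1: "summable (\<lambda>k. q x k * ((h \<bullet> y k) * (w \<bullet> y k)))"
      by (rule qr[of _ "(norm h * R) * (norm w * R)"])
        (use iy R0 in \<open>auto simp: abs_mult intro!: mult_mono\<close>)
    have s2: "summable (\<lambda>k. q x k * (h \<bullet> y k))" for h
      by (rule qr[of _ "norm h * R"]) (rule iy)
    have "(\<lambda>k. q x k * ((h \<bullet> y k) * (w \<bullet> y k)) - (w \<bullet> g x) * (q x k * (h \<bullet> y k))
        - (h \<bullet> g x) * (q x k * (w \<bullet> y k)) + (h \<bullet> g x) * (w \<bullet> g x) * q x k)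
      sums (dN x h \<bullet> w - (w \<bullet> g x) * (h \<bullet> N x) - (h \<bullet> g x) * (w \<bullet> N x) + (h \<bullet> g x) * (w \<bullet> g x) * Z x)"
      unfolding inner_dN inner_N[symmetric] Z_def
      by (intro sums_add sums_diff sums_mult summable_sums s1 s2 qsum)
    moreover have "(\<lambda>k. q x k * ((h \<bullet> y k) * (w \<bullet> y k)) - (w \<bullet> g x) * (q x k * (h \<bullet> y k))
        - (h \<bullet> g x) * (q x k * (w \<bullet> y k)) + (h \<bullet> g x) * (w \<bullet> g x) * q x k)
      = (\<lambda>k. q x k * ((h \<bullet> (y k - g x)) * (w \<bullet> (y k - g x))))"
      by (auto simp: inner_diff_right algebra_simps)
    ultimately have eq: "(\<Sum>k. q x k * ((h \<bullet> (y k - g x)) * (w \<bullet> (y k - g x))))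
      = dN x h \<bullet> w - (w \<bullet> g x) * (h \<bullet> N x) - (h \<bullet> g x) * (w \<bullet> N x) + (h \<bullet> g x) * (w \<bullet> g x) * Z x"
      by (simp add: sums_unique[symmetric])
    show ?thesis
      unfolding eq using Zpos[of x]
      by (simp add: g'_def g_def inner_diff_left inner_commute[of "N x"] field_simps)
  qed
  \<comment> \<open>A hyperplane strictly separating \<open>g x\<close> from \<open>M\<close> would
    also separate it from the weighted mean of the \<open>y k\<close>, which is \<open>g x\<close>
    itself.\<close>
  have gM: "g x \<in> M" for x
  proof (rule ccontr)
    assume "g x \<notin> M"
    then obtain a b where ab: "(a - g x) \<bullet> g x < b" "\<And>z. z \<in> M \<Longrightarrow> b < (a - g x) \<bullet> z"
      using separating_hyperplane_closed_point_inset[OF conv compact_imp_closed[OF comp] ne] by metis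
    have "b * Z x = (\<Sum>k. b * q x k)" unfolding Z_def using suminf_mult[OF qsum] by simp
    also have "\<dots> \<le> (\<Sum>k. q x k * ((a - g x) \<bullet> y k))"
    proof (rule suminf_le)
      show "b * q x k \<le> q x k * ((a - g x) \<bullet> y k)" for k
        using ab(2)[OF yM', of k] qpos[of x k] by (simp add: mult.commute)
      show "summable (\<lambda>k. q x k * ((a - g x) \<bullet> y k))"
        by (rule qr[of _ "norm (a - g x) * R"]) (rule iy)
    qed (intro summable_mult qsum)
    also have "\<dots> = (a - g x) \<bullet> N x" by (rule inner_N)
    also have "\<dots> = ((a - g x) \<bullet> g x) * Z x" using Zpos[of x] by (simp add: g_def)
    finally show False using ab(1) Zpos[of x] by simp
  qed
  have sq: "summable (\<lambda>k. q x k * ((h \<bullet> (y k - g x)) * (h \<bullet> (y k - g x))))" for x h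
  proof (rule qr[of _ "(norm h * (2 * R)) * (norm h * (2 * R))"])
    fix k
    have "norm (y k - g x) \<le> 2 * R"
      using norm_triangle_ineq4[of "y k" "g x"] yR[of k] R[OF gM, of x] by simp
    then have "\<bar>h \<bullet> (y k - g x)\<bar> \<le> norm h * (2 * R)"
      by (intro order_trans[OF Cauchy_Schwarz_ineq2] mult_left_mono) auto
    then show "\<bar>(h \<bullet> (y k - g x)) * (h \<bullet> (y k - g x))\<bar> \<le> (norm h * (2 * R)) * (norm h * (2 * R))"
      unfolding abs_mult by (intro mult_mono) (auto simp: R0)
  qed
  have "body_potential M (\<lambda>x. ln (Z x)) g g'"
    unfolding body_potential_def
  proof (intro conjI allI impI)
    show "((\<lambda>x. ln (Z x)) has_derivative (\<lambda>h. g x \<bullet> h)) (at x)" for x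
      using Zpos[of x] by (auto intro!: derivative_eq_intros derZ simp: g_def inner_commute divide_inverse)
    show "g' x h \<bullet> w = g' x w \<bullet> h" for x h w by (simp add: form mult.commute)
    show "0 \<le> g' x h \<bullet> h" for x h
      unfolding form
      by (intro mult_nonneg_nonneg[OF _ suminf_nonneg[OF sq]] mult_nonneg_nonneg[OF _ zero_le_square])
        (use Zpos[of x] qpos in \<open>auto simp: less_imp_le\<close>)
    show "g' x h \<bullet> h = 0 \<longleftrightarrow> (\<forall>a\<in>M. \<forall>b\<in>M. h \<bullet> a = h \<bullet> b)" for x h
    proof -
      have "g' x h \<bullet> h = 0 \<longleftrightarrow> (\<Sum>k. q x k * ((h \<bullet> (y k - g x)) * (h \<bullet> (y k - g x)))) = 0"
        unfolding form using Zpos[of x] by simp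
      also have "\<dots> \<longleftrightarrow> (\<forall>k. q x k * ((h \<bullet> (y k - g x)) * (h \<bullet> (y k - g x))) = 0)"
        using qpos[of x] by (intro suminf_eq_zero_iff sq) (simp add: less_imp_le)
      also have "\<dots> \<longleftrightarrow> (\<forall>k. h \<bullet> y k = h \<bullet> g x)"
        using qpos[of x] by (simp add: inner_diff_right less_imp_neq[THEN not_sym])
      also have "\<dots> \<longleftrightarrow> (\<forall>a\<in>M. \<forall>b\<in>M. h \<bullet> a = h \<bullet> b)"
      proof
        assume "\<forall>k. h \<bullet> y k = h \<bullet> g x"
        then have "range y \<subseteq> {a. h \<bullet> a = h \<bullet> g x}" by auto
        then have "closure (range y) \<subseteq> {a. h \<bullet> a = h \<bullet> g x}"
          by (intro closure_minimal closed_hyperplane)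
        then have "M \<subseteq> {a. h \<bullet> a = h \<bullet> g x}" using dense by (rule order_trans[rotated])
        then show "\<forall>a\<in>M. \<forall>b\<in>M. h \<bullet> a = h \<bullet> b" by (simp add: subset_iff)
      qed (use yM' gM in blast)
      finally show ?thesis .
    qed
    fix \<delta> :: real assume \<delta>: "0 < \<delta>"
    \<comment> \<open>By compactness finitely many \<open>y k\<close> form a \<delta>-net. Bounding
      \<open>Z x\<close> below by the one term of a nearby net point costs at most
      \<open>m * ln 2\<close>, with \<open>m\<close> bounding the indices in the net.\<close>
    have "M \<subseteq> (\<Union>k\<in>UNIV. ball (y k) \<delta>)"
    proof
      fix a assume "a \<in> M"
      then have "a \<in> closure (range y)" using dense by auto
      then show "a \<in> (\<Union>k\<in>UNIV. ball (y k) \<delta>)"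
        using \<delta> by (auto simp: closure_approachable)
    qed
    then obtain F where F: "F \<subseteq> UNIV" "finite F" "M \<subseteq> (\<Union>k\<in>F. ball (y k) \<delta>)"
      by (rule compactE_image[OF comp, rotated]) auto
    then obtain m where m: "\<And>k. k \<in> F \<Longrightarrow> k \<le> m"
      using finite_nat_set_iff_bounded_le[of F] by auto
    have "x \<bullet> a \<le> ln (Z x) + m * ln 2 + \<delta> * norm x" if a: "a \<in> M" for x a
    proof -
      obtain k where k: "k \<in> F" "dist (y k) a < \<delta>" using F(3) a by auto
      have "q x k \<le> Z x"
        unfolding Z_def using sum_le_suminf[OF qsum, of "{k}" x] qpos[of x] by (auto simp: less_imp_le)
      then have "ln (q x k) \<le> ln (Z x)" using qpos[of x k] by simp
      also have "ln (q x k) = x \<bullet> y k - k * ln 2"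
        by (simp add: q_def c_def ln_mult ln_realpow ln_div)
      finally have "x \<bullet> y k - k * ln 2 \<le> ln (Z x)" .
      moreover have "k * ln 2 \<le> m * ln 2" using m[OF k(1)] by (intro mult_right_mono) auto
      moreover have "x \<bullet> (a - y k) \<le> \<delta> * norm x"
        by (rule order_trans[OF norm_cauchy_schwarz])
          (use k(2) in \<open>auto simp: dist_norm norm_minus_commute mult.commute[of \<delta>] intro!: mult_left_mono\<close>)
      ultimately show ?thesis unfolding inner_diff_right by linarith
    qed
    then show "\<exists>C. \<forall>x. \<forall>a\<in>M. x \<bullet> a \<le> ln (Z x) + C + \<delta> * norm x" by blast
  qed (use derg gM in auto)
  then show ?thesis by blast
qed

section \<open>The volume of Minkowski sums\<close>

text \<open>On the segment from \<open>a\<close> to \<open>b\<close>, the component of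
  \<open>T\<close> in the direction \<open>b - a\<close> has positive derivative, so the end values
  differ.\<close>

lemma has_derivative_strictly_monotone:
  fixes T :: "'a::real_inner \<Rightarrow> 'a"
  assumes der: "\<And>x. (T has_derivative T' x) (at x)" and pos: "\<And>x h. h \<noteq> 0 \<Longrightarrow> 0 < T' x h \<bullet> h"
  shows "inj T"
proof (rule injI, rule ccontr)
  fix a b assume eq: "T a = T b" and "a \<noteq> b"
  define h where "h = b - a"
  have "h \<noteq> 0" using \<open>a \<noteq> b\<close> by (simp add: h_def)
  define p where "p s = T (a + s *\<^sub>R h) \<bullet> h" for s :: real
  have "(p has_real_derivative T' (a + s *\<^sub>R h) h \<bullet> h) (at s)" for s
  proof -
    have "((\<lambda>s. T (a + s *\<^sub>R h)) has_derivative (\<lambda>r. T' (a + s *\<^sub>R h) (r *\<^sub>R h))) (at s)"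
      by (rule has_derivative_compose[OF _ der]) (auto intro!: derivative_eq_intros)
    then have "(p has_derivative (\<lambda>r. T' (a + s *\<^sub>R h) (r *\<^sub>R h) \<bullet> h)) (at s)"
      unfolding p_def[abs_def] by (rule has_derivative_inner_left)
    then show ?thesis
      unfolding has_field_derivative_def
      using linear_cmul[OF has_derivative_linear[OF der]] by (simp add: mult_commute_abs)
  qed
  then have "p 0 < p 1"
    using pos[OF \<open>h \<noteq> 0\<close>] by (intro DERIV_pos_imp_increasing[of 0 1 p]) auto
  then show False using eq by (simp add: p_def h_def)
qed

text \<open>Tilting \<open>F\<close> by the linear functional of \<open>z\<close> leaves a coercive
  function; at its global minimum the gradient \<open>G\<close> equals \<open>z\<close>.\<close>

lemma gradient_attains:
  fixes F :: "'a::euclidean_space \<Rightarrow> real"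
  assumes der: "\<And>x. (F has_derivative (\<lambda>h. G x \<bullet> h)) (at x)"
    and coercive: "0 < e" "\<And>x. z \<bullet> x + e * norm x - C \<le> F x"
  shows "z \<in> range G"
proof -
  define H where "H x = F x - z \<bullet> x" for x
  \<comment> \<open>Outside the ball of radius \<open>r\<close> coercivity gives
    \<open>H w \<ge> F 0 = H 0\<close>, so a minimum over the ball is global.\<close>
  define r where "r = max 0 ((F 0 + C) / e)"
  have contH: "continuous_on X H" for X
  proof -
    have "continuous_on X F"
      by (rule has_derivative_continuous_on, rule has_derivative_at_withinI, rule der)
    then show ?thesis unfolding H_def[abs_def] by (intro continuous_intros)
  qed
  have "\<exists>x\<in>cball 0 r. \<forall>w\<in>cball 0 r. H x \<le> H w"
    by (rule continuous_attains_inf) (auto simp: contH r_def)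
  then obtain x where "\<forall>w\<in>cball 0 r. H x \<le> H w" by blast
  then have x: "\<And>w. norm w \<le> r \<Longrightarrow> H x \<le> H w" by simp
  have min: "H x \<le> H w" for w
  proof (cases "norm w \<le> r")
    case False
    then have "(F 0 + C) / e < norm w" by (simp add: r_def)
    then have "F 0 \<le> e * norm w - C" using \<open>0 < e\<close> by (simp add: field_simps)
    also have "\<dots> \<le> H w" using coercive(2)[of w] by (simp add: H_def)
    finally have "F 0 \<le> H w" .
    then show ?thesis using x[of 0] by (simp add: H_def r_def)
  qed (rule x)
  have "(H has_derivative (\<lambda>h. G x \<bullet> h - z \<bullet> h)) (at x)"
    unfolding H_def[abs_def] by (intro derivative_intros der)
  then have eq: "(\<lambda>h. G x \<bullet> h - z \<bullet> h) = (\<lambda>h. 0)"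
    by (rule differential_zero_maxmin[OF UNIV_I open_UNIV]) (use min in auto)
  have "(G x - z) \<bullet> (G x - z) = 0"
    using fun_cong[OF eq, of "G x - z"] by (simp only: inner_diff_left)
  then show ?thesis by auto
qed

text \<open>Eliminates the leading coefficient, which drives the induction in the next lemma.\<close>

lemma polynomial_dilation_difference:
  fixes c :: "nat \<Rightarrow> real"
  shows "(\<Sum>i\<le>Suc n. c i * (2 * t) ^ i) - 2 ^ Suc n * (\<Sum>i\<le>Suc n. c i * t ^ i)
    = (\<Sum>i\<le>n. (2 ^ i - 2 ^ Suc n) * c i * t ^ i)"
proof -
  have "(\<Sum>i\<le>Suc n. c i * (2 * t) ^ i) - 2 ^ Suc n * (\<Sum>i\<le>Suc n. c i * t ^ i)
    = (\<Sum>i\<le>Suc n. (2 ^ i - 2 ^ Suc n) * c i * t ^ i)"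
    unfolding sum_distrib_left sum_subtractf[symmetric]
    by (intro sum.cong refl) (simp add: power_mult_distrib left_diff_distrib del: power_Suc)
  then show ?thesis by simp
qed

text \<open>Combining the values at \<open>t\<close> and \<open>2 * t\<close> removes the top
  coefficient and multiplies each lower one by a nonzero constant. The induction hypothesis recovers
  the lower coefficients; the top one is what remains at \<open>t = 1\<close>.\<close>

lemma polynomial_coefficients_integrable:
  fixes c :: "nat \<Rightarrow> 'a::euclidean_space \<Rightarrow> real"
  assumes "\<And>t. 0 < t \<Longrightarrow> (\<lambda>x. \<Sum>i\<le>n. c i x * t ^ i) integrable_on S" and "i \<le> n"
  shows "c i integrable_on S"
  using assms
proof (induction n arbitrary: c i)
  case 0
  from "0.prems"(1)[of 1] "0.prems"(2) show ?case by simp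
next
  case (Suc n)
  have low: "c i integrable_on S" if "i \<le> n" for i
  proof -
    have "(\<lambda>x. \<Sum>i\<le>n. (2 ^ i - 2 ^ Suc n) * c i x * t ^ i) integrable_on S" if "0 < t" for t :: real
      unfolding polynomial_dilation_difference[symmetric]
      by (rule integrable_diff; (rule integrable_on_mult_right)?; rule Suc.prems(1)) (use that in simp_all)
    then have "(\<lambda>x. (2 ^ i - 2 ^ Suc n) * c i x) integrable_on S"
      by (rule Suc.IH[of "\<lambda>i x. (2 ^ i - 2 ^ Suc n) * c i x", OF _ that])
    moreover have "(2::real) ^ i - 2 ^ Suc n \<noteq> 0"
      using that power_strict_increasing[of i "Suc n" "2::real"] by simp
    ultimately show ?thesis
      using integrable_on_cmult_iff[of "2 ^ i - 2 ^ Suc n" "c i" S] by blast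
  qed
  have "(\<lambda>x. (\<Sum>i\<le>Suc n. c i x * 1 ^ i) - (\<Sum>i\<le>n. c i x)) integrable_on S"
    by (rule integrable_diff[OF Suc.prems(1) integrable_sum]) (use low in auto)
  then have "c (Suc n) integrable_on S" by simp
  with low Suc.prems(2) show ?case by (cases "i = Suc n") auto
qed

text \<open>With zero integral a positive function would vanish almost everywhere, making the whole
  space a null set.\<close>

lemma integral_pos_UNIV:
  fixes f :: "'a::euclidean_space \<Rightarrow> real"
  assumes f: "f integrable_on UNIV" and pos: "\<And>x. 0 < f x"
  shows "0 < integral UNIV f"
proof -
  have "f absolutely_integrable_on UNIV"
    using f pos by (intro nonnegative_absolutely_integrable_1) (auto simp: less_imp_le)
  then have int: "integrable lebesgue f" and eq: "integral\<^sup>L lebesgue f = integral UNIV f"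
    using set_lebesgue_integral_eq_integral(2)[of UNIV f]
    by (auto simp: set_integrable_def set_lebesgue_integral_def)
  have "integral\<^sup>L lebesgue f \<noteq> 0"
  proof
    assume "integral\<^sup>L lebesgue f = 0"
    then have "AE x in lebesgue. f x = 0"
      using integral_nonneg_eq_0_iff_AE[OF int] pos by (simp add: less_imp_le)
    moreover have "{x \<in> space lebesgue. f x \<noteq> 0} = UNIV" using pos by (auto simp: less_imp_neq[THEN not_sym])
    ultimately have "UNIV \<in> null_sets (lebesgue :: 'a measure)"
      using AE_iff_null[of lebesgue "\<lambda>x. f x = 0"] by simp
    then show False by (simp add: null_sets_def)
  qed
  moreover have "0 \<le> integral UNIV f" using f pos by (intro integral_nonneg) (auto simp: less_imp_le)
  ultimately show ?thesis using eq by simp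
qed

section \<open>Minkowski combinations and affine dimension\<close>

lemma scaled_Minkowski_sum:
  assumes "convex_body M" "convex_body E"
  shows "convex_body (M + (\<lambda>x. t *\<^sub>R x) ` E)"
proof -
  have "M + (\<lambda>x. t *\<^sub>R x) ` E = {x + y | x y. x \<in> M \<and> y \<in> (\<lambda>x. t *\<^sub>R x) ` E}"
    by (auto simp: set_plus_def)
  then have "compact (M + (\<lambda>x. t *\<^sub>R x) ` E)"
    using compact_sums[of M "(\<lambda>x. t *\<^sub>R x) ` E"] assms compact_scaling[of E t]
    by (simp add: convex_body_def)
  moreover have "convex (M + (\<lambda>x. t *\<^sub>R x) ` E)"
    using assms by (intro convex_set_plus convex_scaling) (auto simp: convex_body_def)
  moreover have "M + (\<lambda>x. t *\<^sub>R x) ` E \<noteq> {}"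
    using assms by (auto simp: convex_body_def set_plus_def)
  ultimately show ?thesis by (simp add: convex_body_def)
qed

text \<open>The directions in question form the orthogonal complement of the linear space parallel
  to the affine hull of \<open>M\<close>. This turns the nullity of a Hessian into the dimension of
  the body.\<close>

lemma aff_dim_orthogonal_directions:
  fixes M :: "'a::euclidean_space set"
  assumes "M \<noteq> {}"
  shows "int (dim {h. \<forall>a\<in>M. \<forall>b\<in>M. h \<bullet> a = h \<bullet> b}) + aff_dim M = int DIM('a)"
proof -
  obtain a where a: "a \<in> M" using assms by auto
  define D where "D = (\<lambda>x. x - a) ` M"
  have "{h. \<forall>a\<in>M. \<forall>b\<in>M. h \<bullet> a = h \<bullet> b} = {h \<in> UNIV. \<forall>x\<in>span D. orthogonal x h}"
  proof (intro set_eqI iffI)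
    fix h assume h: "h \<in> {h. \<forall>a\<in>M. \<forall>b\<in>M. h \<bullet> a = h \<bullet> b}"
    have "orthogonal h x" if "x \<in> span D" for x
    proof (rule orthogonal_to_span[OF that])
      fix y assume "y \<in> D"
      then obtain b where b: "b \<in> M" "y = b - a" by (auto simp: D_def)
      then have "h \<bullet> b = h \<bullet> a" using h a by blast
      then show "orthogonal h y" by (simp add: b orthogonal_def inner_diff_right)
    qed
    then show "h \<in> {h \<in> UNIV. \<forall>x\<in>span D. orthogonal x h}" by (simp add: orthogonal_commute)
  next
    fix h assume "h \<in> {h \<in> UNIV. \<forall>x\<in>span D. orthogonal x h}"
    then have "(x - a) \<bullet> h = 0" if "x \<in> M" for x
      using that span_base[of "x - a" D] by (auto simp: D_def orthogonal_def)
    then have *: "h \<bullet> x = h \<bullet> a" if "x \<in> M" for x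
      using that by (metis eq_iff_diff_eq_0 inner_commute inner_diff_left)
    show "h \<in> {h. \<forall>a\<in>M. \<forall>b\<in>M. h \<bullet> a = h \<bullet> b}"
      by (intro CollectI ballI) (rule trans[OF * *[symmetric]])
  qed
  then have "dim {h. \<forall>a\<in>M. \<forall>b\<in>M. h \<bullet> a = h \<bullet> b} + dim D = DIM('a)"
    using dim_subspace_orthogonal_to_vectors[of "span D" UNIV] by simp
  moreover have "aff_dim M = int (dim D)"
    using aff_dim_eq_dim_subtract[of a M] a by (simp add: D_def hull_inc)
  ultimately show ?thesis by simp
qed

section \<open>Change of variables by gradient maps\<close>

lemma body_potentialD:
  assumes "body_potential M \<phi> g g'"
  shows "(\<phi> has_derivative (\<lambda>h. g x \<bullet> h)) (at x)"
    and "(g has_derivative g' x) (at x)"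
    and "g x \<in> M"
    and "g' x h \<bullet> w = g' x w \<bullet> h"
    and "0 \<le> g' x h \<bullet> h"
    and "g' x h \<bullet> h = 0 \<longleftrightarrow> (\<forall>a\<in>M. \<forall>b\<in>M. h \<bullet> a = h \<bullet> b)"
    and "0 < \<delta> \<Longrightarrow> \<exists>C. \<forall>x. \<forall>a\<in>M. x \<bullet> a \<le> \<phi> x + C + \<delta> * norm x"
proof -
  note D = assms[unfolded body_potential_def]
  show "(\<phi> has_derivative (\<lambda>h. g x \<bullet> h)) (at x)" using D by (elim conjE) (rule spec)
  show "(g has_derivative g' x) (at x)" using D by (elim conjE) (rule spec)
  show "g x \<in> M" using D by (elim conjE) (rule spec)
  show "g' x h \<bullet> w = g' x w \<bullet> h" using D by (elim conjE) (erule allE, erule allE, erule allE)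
  show "0 \<le> g' x h \<bullet> h" using D by blast
  show "g' x h \<bullet> h = 0 \<longleftrightarrow> (\<forall>a\<in>M. \<forall>b\<in>M. h \<bullet> a = h \<bullet> b)" using D by blast
  show "0 < \<delta> \<Longrightarrow> \<exists>C. \<forall>x. \<forall>a\<in>M. x \<bullet> a \<le> \<phi> x + C + \<delta> * norm x" using D by blast
qed

text \<open>A ball of radius \<open>e\<close> around \<open>z\<close> inside the sum puts the
  support function of the sum at least \<open>e * norm x\<close> above \<open>z \<bullet> x\<close>.
  The potentials lose at most half of this margin, so
  \<open>\<phi> x + t * \<psi> x - z \<bullet> x\<close> is coercive and \<open>z\<close> is
  attained as a gradient.\<close>

lemma body_potential_surjective:
  assumes M: "body_potential M \<phi> g g'" and E: "body_potential E \<psi> f f'" and t: "0 < t"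
  shows "interior (M + (\<lambda>x. t *\<^sub>R x) ` E) \<subseteq> range (\<lambda>x. g x + t *\<^sub>R f x)"
proof
  fix z assume "z \<in> interior (M + (\<lambda>x. t *\<^sub>R x) ` E)"
  then obtain e where e: "0 < e" "cball z e \<subseteq> M + (\<lambda>x. t *\<^sub>R x) ` E"
    by (auto simp: mem_interior_cball)
  \<comment> \<open>The losses \<delta> for \<open>M\<close> and \<open>t\<close> times \<delta> for
    \<open>E\<close> add up to \<open>e / 2\<close>.\<close>
  define \<delta> where "\<delta> = e / (2 * (1 + t))"
  have \<delta>: "0 < \<delta>" "\<delta> * (1 + t) = e / 2" using e t by (auto simp: \<delta>_def field_simps)
  obtain C1 where C1: "\<And>x a. a \<in> M \<Longrightarrow> x \<bullet> a \<le> \<phi> x + C1 + \<delta> * norm x"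
    using body_potentialD(7)[OF M \<delta>(1)] by blast
  obtain C2 where C2: "\<And>x a. a \<in> E \<Longrightarrow> x \<bullet> a \<le> \<psi> x + C2 + \<delta> * norm x"
    using body_potentialD(7)[OF E \<delta>(1)] by blast
  show "z \<in> range (\<lambda>x. g x + t *\<^sub>R f x)"
  proof (rule gradient_attains)
    have "((\<lambda>x. \<phi> x + t * \<psi> x) has_derivative (\<lambda>h. g x \<bullet> h + t * (f x \<bullet> h))) (at x)" for x
      by (intro derivative_intros body_potentialD(1)[OF M] body_potentialD(1)[OF E])
    then show "((\<lambda>x. \<phi> x + t * \<psi> x) has_derivative (\<lambda>h. (g x + t *\<^sub>R f x) \<bullet> h)) (at x)" for x
      by (simp only: inner_add_left inner_scaleR_left)
    show "0 < e / 2" using e by simp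
    fix x
    \<comment> \<open>The point of the ball farthest in direction \<open>x\<close>. For
      \<open>x = 0\<close> division by zero gives \<open>u = z\<close>, which serves as
      well.\<close>
    define u where "u = z + (e / norm x) *\<^sub>R x"
    have "u \<in> cball z e" using e by (auto simp: u_def dist_norm)
    then have "u \<in> M + (\<lambda>x. t *\<^sub>R x) ` E" using e by blast
    then obtain a b where ab: "a \<in> M" "b \<in> E" "u = a + t *\<^sub>R b" by (auto simp: set_plus_def)
    have "z \<bullet> x + e * norm x = x \<bullet> u"
      by (cases "x = 0") (auto simp: u_def inner_add_right inner_commute[of z] dot_square_norm power2_eq_square)
    also have "x \<bullet> u = x \<bullet> a + t * (x \<bullet> b)" by (simp add: ab inner_add_right)
    also have "\<dots> \<le> (\<phi> x + C1 + \<delta> * norm x) + t * (\<psi> x + C2 + \<delta> * norm x)"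
      using t by (intro add_mono mult_left_mono C1 C2 ab) auto
    also have "\<dots> = \<phi> x + t * \<psi> x + (C1 + t * C2) + (\<delta> * (1 + t)) * norm x"
      by (simp add: algebra_simps)
    finally show "z \<bullet> x + e / 2 * norm x - (C1 + t * C2) \<le> \<phi> x + t * \<psi> x"
      unfolding \<delta>(2) by simp
  qed
qed

text \<open>The map \<open>T\<close> is injective, and its range lies between the interior of the
  sum and the sum. The boundary of a convex set is negligible, so the range has the volume of the
  sum.\<close>

lemma Minkowski_sum_volume_eq_integral:
  fixes M E :: "(real ^ 'n::{finite,wellorder}) set"
  assumes M: "convex_body M" and E: "convex_body E"
    and potM: "body_potential M \<phi> g g'" and potE: "body_potential E \<psi> f f'"
    and fpd: "\<And>x h. h \<noteq> 0 \<Longrightarrow> 0 < f' x h \<bullet> h" and t: "0 < t"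
  defines "J \<equiv> \<lambda>x. \<bar>det (matrix (\<lambda>h. g' x h + t *\<^sub>R f' x h))\<bar>"
  shows "J integrable_on UNIV" and "measure lebesgue (M + (\<lambda>x. t *\<^sub>R x) ` E) = integral UNIV J"
proof -
  define D where "D = M + (\<lambda>x. t *\<^sub>R x) ` E"
  define T where "T x = g x + t *\<^sub>R f x" for x
  have derT: "(T has_derivative (\<lambda>h. g' x h + t *\<^sub>R f' x h)) (at x)" for x
    unfolding T_def[abs_def] by (intro derivative_intros body_potentialD(2)[OF potM] body_potentialD(2)[OF potE])
  have injT: "inj T"
  proof (rule has_derivative_strictly_monotone[OF derT])
    fix x h :: "(real,'n) vec" assume "h \<noteq> 0"
    then have "0 < t * (f' x h \<bullet> h)" using t fpd by simp
    moreover have "0 \<le> g' x h \<bullet> h" by (rule body_potentialD(5)[OF potM])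
    ultimately show "0 < (g' x h + t *\<^sub>R f' x h) \<bullet> h" by (simp add: inner_add_left)
  qed
  have "convex_body D" unfolding D_def by (rule scaled_Minkowski_sum[OF M E])
  then have D: "compact D" "convex D" by (auto simp: convex_body_def)
  have sub: "range T \<subseteq> D"
    using body_potentialD(3)[OF potM] body_potentialD(3)[OF potE] by (auto simp: T_def D_def)
  have "interior D \<subseteq> range T"
    unfolding D_def T_def[abs_def] by (rule body_potential_surjective[OF potM potE t])
  then have "D - range T \<subseteq> frontier D"
    using compact_imp_closed[OF D(1)] by (auto simp: frontier_def)
  then have "negligible (D - range T)"
    using negligible_convex_frontier[OF D(2)] negligible_subset by blast
  moreover have "range T - D = {}" using sub by blast
  ultimately have neg: "negligible (D - range T \<union> (range T - D))" by simp
  have mD: "D \<in> lmeasurable" using D(1) by (rule lmeasurable_compact)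
  have mT: "range T \<in> lmeasurable"
    by (rule lmeasurable_negligible_symdiff[OF mD neg])
  have eqT: "measure lebesgue (range T) = measure lebesgue D"
    by (rule measure_negligible_symdiff[OF mD neg])
  have UNIV: "UNIV \<in> sets lebesgue" by simp
  \<comment> \<open>Integrability of the Jacobian is read off from the finite measure of the
    range.\<close>
  show int: "J integrable_on UNIV"
    using measurable_differentiable_image_eq[OF UNIV derT injT] mT by (simp add: J_def)
  show "measure lebesgue (M + (\<lambda>x. t *\<^sub>R x) ` E) = integral UNIV J"
    using measure_differentiable_image_eq[OF UNIV derT injT int[unfolded J_def]] eqT
    by (simp add: J_def D_def)
qed

text \<open>The coefficients are the integrals of those of the pointwise determinant. Whether a
  pointwise coefficient vanishes depends only on \<open>i\<close> and \<open>aff_dim M\<close>, so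
  each one is zero everywhere or positive everywhere.\<close>

proposition Minkowski_sum_volume_wellorder:
  fixes M E :: "(real ^ 'n::{finite,wellorder}) set"
  assumes M: "convex_body M" and E: "convex_body E" and full: "aff_dim E = int CARD('n)"
  obtains v :: "nat \<Rightarrow> real"
  where "\<And>t. 0 < t \<Longrightarrow> measure lebesgue (M + (\<lambda>x. t *\<^sub>R x) ` E) = (\<Sum>i\<le>CARD('n). v i * t ^ i)"
    "\<And>i. 0 \<le> v i"
    "\<And>i. i \<le> CARD('n) \<Longrightarrow> v i = 0 \<longleftrightarrow> aff_dim M + int i < int CARD('n)"
proof -
  have M': "M \<noteq> {}" "compact M" "convex M" and E': "E \<noteq> {}" "compact E" "convex E"
    using M E by (auto simp: convex_body_def)
  obtain \<phi> g g' where potM: "body_potential M \<phi> g g'"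
    using body_potential_exists[OF M'] by blast
  obtain \<psi> f f' where potE: "body_potential E \<psi> f f'"
    using body_potential_exists[OF E'] by blast
  note g = body_potentialD[OF potM] and f = body_potentialD[OF potE]
  \<comment> \<open>No nonzero direction is constant on a full-dimensional \<open>E\<close>, so
    \<open>f'\<close> is positive definite.\<close>
  have "dim {h. \<forall>a\<in>E. \<forall>b\<in>E. h \<bullet> a = h \<bullet> b} = 0"
    using aff_dim_orthogonal_directions[OF E'(1)] full by simp
  then have "h = 0" if "\<forall>a\<in>E. \<forall>b\<in>E. h \<bullet> a = h \<bullet> b" for h
    using that unfolding dim_eq_0 by blast
  then have fpd: "0 < f' x h \<bullet> h" if "h \<noteq> 0" for x h
    using f(5)[of x h] f(6)[of x h] that by (metis less_le)
  have ling: "linear (g' x)" and linf: "linear (f' x)" for x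
    by (rule has_derivative_linear, rule g(2), rule has_derivative_linear, rule f(2))
  have "\<forall>x. \<exists>c. (\<forall>t. det (matrix (\<lambda>h. g' x h + t *\<^sub>R f' x h)) = (\<Sum>i\<le>CARD('n). c i * t ^ i)) \<and>
      (\<forall>i. 0 \<le> c i) \<and> (\<forall>i\<le>CARD('n). c i = 0 \<longleftrightarrow> i < dim {h. g' x h \<bullet> h = 0})"
    (is "\<forall>x. \<exists>c. ?P x c")
  proof
    show "\<exists>c. ?P x c" for x
      by (rule det_pencil[OF ling[of x] linf[of x] g(4) f(4) g(5) fpd]) blast+
  qed
  then obtain c where C: "\<forall>x. ?P x (c x)"
    by (rule choice[THEN exE])
  have c: "det (matrix (\<lambda>h. g' x h + t *\<^sub>R f' x h)) = (\<Sum>i\<le>CARD('n). c x i * t ^ i)"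
    and cnonneg: "0 \<le> c x i"
    and c0: "i \<le> CARD('n) \<Longrightarrow> c x i = 0 \<longleftrightarrow> i < dim {h. g' x h \<bullet> h = 0}" for x t i
    using C by blast+
  have c0': "c x i = 0 \<longleftrightarrow> aff_dim M + int i < int CARD('n)" if "i \<le> CARD('n)" for x i
  proof -
    have "int (dim {h. g' x h \<bullet> h = 0}) + aff_dim M = int CARD('n)"
      using aff_dim_orthogonal_directions[OF M'(1)] unfolding g(6) by simp
    then show ?thesis unfolding c0[OF that] by linarith
  qed
  have vol: "(\<lambda>x. \<Sum>i\<le>CARD('n). c x i * t ^ i) integrable_on UNIV"
      "measure lebesgue (M + (\<lambda>x. t *\<^sub>R x) ` E) = integral UNIV (\<lambda>x. \<Sum>i\<le>CARD('n). c x i * t ^ i)"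
    if t: "0 < t" for t
  proof -
    have J: "(\<lambda>x. \<bar>det (matrix (\<lambda>h. g' x h + t *\<^sub>R f' x h))\<bar>) = (\<lambda>x. \<Sum>i\<le>CARD('n). c x i * t ^ i)"
      unfolding c using t by (intro ext abs_of_nonneg sum_nonneg mult_nonneg_nonneg cnonneg) auto
    show "(\<lambda>x. \<Sum>i\<le>CARD('n). c x i * t ^ i) integrable_on UNIV"
      using Minkowski_sum_volume_eq_integral(1)[OF M E potM potE fpd t] unfolding J .
    show "measure lebesgue (M + (\<lambda>x. t *\<^sub>R x) ` E) = integral UNIV (\<lambda>x. \<Sum>i\<le>CARD('n). c x i * t ^ i)"
      using Minkowski_sum_volume_eq_integral(2)[OF M E potM potE fpd t] unfolding J .
  qed
  have cint: "(\<lambda>x. c x i) integrable_on UNIV" if "i \<le> CARD('n)" for i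
    using polynomial_coefficients_integrable[where n = "CARD('n)" and c = "\<lambda>i x. c x i", OF vol(1) that] .
  show ?thesis
  proof (rule that[of "\<lambda>i. integral UNIV (\<lambda>x. c x i)"])
    fix t :: real assume "0 < t"
    have "integral UNIV (\<lambda>x. \<Sum>i\<le>CARD('n). c x i * t ^ i) = (\<Sum>i\<le>CARD('n). integral UNIV (\<lambda>x. c x i * t ^ i))"
      by (rule integral_sum[OF finite_atMost], rule integrable_on_mult_left, rule cint) simp
    then show "measure lebesgue (M + (\<lambda>x. t *\<^sub>R x) ` E) = (\<Sum>i\<le>CARD('n). integral UNIV (\<lambda>x. c x i) * t ^ i)"
      using vol(2)[OF \<open>0 < t\<close>] by simp
  next
    \<comment> \<open>Here \<open>i\<close> may exceed \<open>CARD('n)\<close>, where integrability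
      is not established; a non-integrable function has integral 0 by convention.\<close>
    show "0 \<le> integral UNIV (\<lambda>x. c x i)" for i
    proof (cases "(\<lambda>x. c x i) integrable_on UNIV")
      case True
      then show ?thesis by (rule integral_nonneg) (rule cnonneg)
    qed (simp add: not_integrable_integral)
  next
    fix i assume i: "i \<le> CARD('n)"
    show "integral UNIV (\<lambda>x. c x i) = 0 \<longleftrightarrow> aff_dim M + int i < int CARD('n)"
    proof (cases "aff_dim M + int i < int CARD('n)")
      case True
      then have "c x i = 0" for x using c0'[OF i] by blast
      then show ?thesis using True by simp
    next
      case False
      then have "0 < c x i" for x using c0'[OF i, of x] cnonneg[of x i] by (metis less_le)
      then have "0 < integral UNIV (\<lambda>x. c x i)" by (rule integral_pos_UNIV[OF cint[OF i]])
      then show ?thesis using False by simp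
    qed
  qed
qed

section \<open>Arbitrary finite index types\<close>

text \<open>The change-of-variables theorem of the library requires a well-ordered index type.\<close>

typedef 'a ordered_copy = "UNIV :: 'a set" by simp

lemma Rep_ordered_copy_image: "Rep_ordered_copy ` UNIV = (UNIV :: 'a set)"
  by (metis Abs_ordered_copy_inverse UNIV_I surj_def)

lemma bij_Rep_ordered_copy: "bij (Rep_ordered_copy :: 'a ordered_copy \<Rightarrow> 'a)"
  by (simp add: bij_def Rep_ordered_copy_image inj_def Rep_ordered_copy_inject)

instance ordered_copy :: (finite) finite
proof
  show "finite (UNIV :: 'a ordered_copy set)"
    using bij_betw_finite[OF bij_Rep_ordered_copy] finite by blast
qed

instantiation ordered_copy :: (finite) wellorder
begin

definition less_eq_ordered_copy :: "'a ordered_copy \<Rightarrow> 'a ordered_copy \<Rightarrow> bool" where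
  "a \<le> b \<longleftrightarrow> to_nat_on UNIV (Rep_ordered_copy a) \<le> to_nat_on UNIV (Rep_ordered_copy b)"

definition less_ordered_copy :: "'a ordered_copy \<Rightarrow> 'a ordered_copy \<Rightarrow> bool" where
  "a < b \<longleftrightarrow> to_nat_on UNIV (Rep_ordered_copy a) < to_nat_on UNIV (Rep_ordered_copy b)"

instance
proof
  fix a b :: "'a ordered_copy"
  have inj: "inj (to_nat_on (UNIV :: 'a set))"
    by (intro inj_on_to_nat_on countable_finite finite)
  show "a \<le> b \<Longrightarrow> b \<le> a \<Longrightarrow> a = b"
    unfolding less_eq_ordered_copy_def using inj
    by (metis Rep_ordered_copy_inject antisym injD)
  fix P :: "'a ordered_copy \<Rightarrow> bool"
  assume step: "\<And>x. (\<And>y. y < x \<Longrightarrow> P y) \<Longrightarrow> P x"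
  show "P a"
    by (rule measure_induct[of "\<lambda>x. to_nat_on UNIV (Rep_ordered_copy x)" P])
      (rule step, simp add: less_ordered_copy_def)
qed (auto simp: less_eq_ordered_copy_def less_ordered_copy_def)

end

lemma CARD_ordered_copy: "CARD('a ordered_copy) = CARD('a)"
  by (rule bij_betw_same_card[OF bij_Rep_ordered_copy])

definition reindex :: "real ^ 'n \<Rightarrow> real ^ 'n ordered_copy" where
  "reindex x = (\<chi> i. x $ Rep_ordered_copy i)"

definition unreindex :: "real ^ 'n ordered_copy \<Rightarrow> real ^ 'n" where
  "unreindex y = (\<chi> i. y $ Abs_ordered_copy i)"

lemma unreindex_reindex: "unreindex (reindex x) = x"
  by (simp add: unreindex_def reindex_def Abs_ordered_copy_inverse)

lemma reindex_unreindex: "reindex (unreindex x) = x"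
  by (simp add: unreindex_def reindex_def Rep_ordered_copy_inverse)

lemma linear_reindex: "linear reindex" and linear_unreindex: "linear unreindex"
  by (auto simp: linear_iff reindex_def unreindex_def vec_eq_iff)

lemma inj_reindex: "inj reindex"
  by (metis injI unreindex_reindex)

lemma reindex_image_cbox: "reindex ` cbox a b = cbox (reindex a) (reindex b)"
proof (intro equalityI subsetI)
  fix y assume y: "y \<in> cbox (reindex a) (reindex b)"
  have "unreindex y \<in> cbox a b"
    using y unfolding mem_box_cart
    by (simp add: reindex_def unreindex_def) (metis Abs_ordered_copy_inverse UNIV_I)
  then show "y \<in> reindex ` cbox a b" by (metis image_eqI reindex_unreindex)
qed (auto simp: mem_box_cart reindex_def)

lemma unreindex_image_cbox: "unreindex ` cbox a b = cbox (unreindex a) (unreindex b)"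
proof -
  have "cbox a b = reindex ` cbox (unreindex a) (unreindex b)"
    by (simp add: reindex_image_cbox reindex_unreindex)
  then show ?thesis by (simp add: image_image unreindex_reindex)
qed

lemma content_unreindex_cbox: "measure lborel (unreindex ` cbox a b) = measure lborel (cbox a b)"
proof (cases "cbox a b = {}")
  case False
  then have ne: "cbox (unreindex a) (unreindex b) \<noteq> {}"
    by (simp add: unreindex_image_cbox[symmetric])
  have "(\<Prod>i\<in>UNIV. unreindex b $ i - unreindex a $ i)
      = (\<Prod>j\<in>UNIV. unreindex b $ Rep_ordered_copy j - unreindex a $ Rep_ordered_copy j)"
    by (rule prod.reindex_bij_betw[OF bij_Rep_ordered_copy, symmetric])
  then show ?thesis
    using False ne by (simp add: unreindex_image_cbox content_cbox_cart)
      (simp add: unreindex_def Rep_ordered_copy_inverse)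
qed simp

text \<open>Permuting coordinates maps boxes to boxes of equal content, so the gauge integral of the
  indicator function is transported unchanged. Compactness provides a box to integrate over.\<close>

lemma measure_reindex_image:
  fixes S :: "(real ^ 'n) set"
  assumes "compact S"
  shows "measure lebesgue (reindex ` S) = measure lebesgue S"
proof -
  obtain a where a: "S \<subseteq> cbox (- a) a"
    using bounded_subset_cbox_symmetric[OF compact_imp_bounded[OF assms]] .
  have "(indicat_real S has_integral measure lebesgue S) UNIV"
    using lmeasurable_compact[OF assms] lmeasurable_iff_indicator_has_integral by blast
  also have "indicat_real S = (\<lambda>x. if x \<in> cbox (- a) a then indicat_real S x else 0)"
    using a by (auto simp: indicator_def fun_eq_iff)
  finally have "(indicat_real S has_integral measure lebesgue S) (cbox (- a) a)"
    by (simp only: has_integral_restrict_UNIV)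
  then have "((\<lambda>x. indicat_real S (unreindex x)) has_integral (1 / 1) *\<^sub>R measure lebesgue S) (reindex ` cbox (- a) a)"
  proof (rule has_integral_twiddle[rotated -1])
    show "continuous (at x) unreindex" for x
      using linear_unreindex by (intro linear_continuous_at) (simp add: linear_conv_bounded_linear)
    show "\<exists>w z. unreindex ` cbox u v = cbox w z" for u v using unreindex_image_cbox by blast
    show "\<exists>w z. reindex ` cbox u v = cbox w z" for u v using reindex_image_cbox by blast
  qed (simp_all add: unreindex_reindex reindex_unreindex content_unreindex_cbox)
  also have "(\<lambda>x. indicat_real S (unreindex x)) = indicat_real (reindex ` S)"
    by (auto simp: indicator_def fun_eq_iff unreindex_reindex) (metis image_eqI reindex_unreindex)
  finally have "((\<lambda>x. if x \<in> reindex ` cbox (- a) a then indicat_real (reindex ` S) x else 0)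
      has_integral measure lebesgue S) UNIV"
    by (simp add: has_integral_restrict_UNIV)
  also have "(\<lambda>x. if x \<in> reindex ` cbox (- a) a then indicat_real (reindex ` S) x else 0) = indicat_real (reindex ` S)"
  proof -
    have "reindex ` S \<subseteq> reindex ` cbox (- a) a" using a by (rule image_mono)
    then show ?thesis unfolding indicator_def fun_eq_iff by auto
  qed
  finally show ?thesis
    using lmeasurable_iff_indicator_has_integral[of "reindex ` S" "measure lebesgue S"] by simp
qed

text \<open>\<open>reindex\<close> is a linear isomorphism that preserves convex bodies, affine
  dimension, Minkowski combinations and volume, so the well-ordered case carries over.\<close>

proposition Minkowski_sum_volume:
  fixes M E :: "(real ^ 'n) set"
  assumes M: "convex_body M" and E: "convex_body E" and full: "aff_dim E = int CARD('n)"
  obtains v :: "nat \<Rightarrow> real"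
  where "\<And>t. 0 < t \<Longrightarrow> measure lebesgue (M + (\<lambda>x. t *\<^sub>R x) ` E) = (\<Sum>i\<le>CARD('n). v i * t ^ i)"
    "\<And>i. 0 \<le> v i"
    "\<And>i. i \<le> CARD('n) \<Longrightarrow> v i = 0 \<longleftrightarrow> aff_dim M + int i < int CARD('n)"
proof -
  have body: "convex_body (reindex ` A)" if "convex_body A" for A :: "(real ^ 'n) set"
    using that linear_reindex
    by (auto simp: convex_body_def linear_linear intro!: compact_continuous_image linear_continuous_on convex_linear_image)
  have dim: "aff_dim (reindex ` A) = aff_dim A" for A :: "(real ^ 'n) set"
    by (rule aff_dim_injective_linear_image[OF linear_reindex inj_reindex])
  obtain v where v: "\<And>t. 0 < t \<Longrightarrow> measure lebesgue (reindex ` M + (\<lambda>x. t *\<^sub>R x) ` (reindex ` E)) = (\<Sum>i\<le>CARD('n). v i * t ^ i)"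
    "\<And>i. 0 \<le> v i"
    "\<And>i. i \<le> CARD('n) \<Longrightarrow> v i = 0 \<longleftrightarrow> aff_dim M + int i < int CARD('n)"
    using Minkowski_sum_volume_wellorder[OF body[OF M] body[OF E]] full
    unfolding dim CARD_ordered_copy by blast
  have "reindex ` M + (\<lambda>x. t *\<^sub>R x) ` (reindex ` E) = reindex ` (M + (\<lambda>x. t *\<^sub>R x) ` E)" for t
    by (force simp: set_plus_def image_iff linear_add[OF linear_reindex] linear_cmul[OF linear_reindex])
  moreover have "compact (M + (\<lambda>x. t *\<^sub>R x) ` E)" for t
    using scaled_Minkowski_sum[OF M E] by (simp add: convex_body_def)
  ultimately have "measure lebesgue (M + (\<lambda>x. t *\<^sub>R x) ` E) = (\<Sum>i\<le>CARD('n). v i * t ^ i)" if "0 < t" for t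
    using v(1)[OF that] by (simp add: measure_reindex_image)
  then show ?thesis using v(2,3) by (rule that)
qed

section \<open>Relative quermassintegrals\<close>

text \<open>\<open>x + t *\<^sub>R y\<close> is \<open>1 + t\<close> times a convex combination of
  \<open>x\<close> and \<open>y\<close>.\<close>

lemma convex_Minkowski_dilate:
  fixes E :: "'a::real_vector set"
  assumes "convex E" "0 \<le> t"
  shows "E + (\<lambda>x. t *\<^sub>R x) ` E = (\<lambda>x. (1 + t) *\<^sub>R x) ` E"
proof (intro equalityI subsetI)
  fix z assume "z \<in> E + (\<lambda>x. t *\<^sub>R x) ` E"
  then obtain x y where xy: "x \<in> E" "y \<in> E" "z = x + t *\<^sub>R y" by (auto simp: set_plus_def)
  have "(1 / (1 + t)) *\<^sub>R x + (t / (1 + t)) *\<^sub>R y \<in> E"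
    using assms xy by (intro convexD) (auto simp: field_simps)
  moreover have "z = (1 + t) *\<^sub>R ((1 / (1 + t)) *\<^sub>R x + (t / (1 + t)) *\<^sub>R y)"
    using assms(2) by (simp add: xy(3) scaleR_right_distrib)
  ultimately show "z \<in> (\<lambda>x. (1 + t) *\<^sub>R x) ` E" by blast
next
  fix z assume "z \<in> (\<lambda>x. (1 + t) *\<^sub>R x) ` E"
  then obtain x where "x \<in> E" "z = x + t *\<^sub>R x" by (auto simp: scaleR_left_distrib)
  then show "z \<in> E + (\<lambda>x. t *\<^sub>R x) ` E" by (auto simp: set_plus_def)
qed

text \<open>Both sides count pairs of an \<open>i\<close>-set inside an \<open>m\<close>-set. With
  lower entry \<open>n - m\<close> the right side vanishes by itself for \<open>m < i\<close>, so
  sums need no case distinction.\<close>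

lemma choose_mult_complement:
  assumes "m \<le> n" "i \<le> n"
  shows "(n choose m) * (m choose i) = (n choose i) * ((n - i) choose (n - m))"
proof (cases "i \<le> m")
  case True
  then have "(n - i) choose (m - i) = (n - i) choose (n - m)"
    using assms by (subst binomial_symmetric) auto
  then show ?thesis using choose_mult[OF True assms(1)] by simp
next
  case False
  then have "m choose i = 0" "(n - i) choose (n - m) = 0" using assms by (auto simp: binomial_eq_0_iff)
  then show ?thesis by (simp only: mult_0_right)
qed

text \<open>Since \<open>M + E + t E = M + (1 + t) E\<close>, the volume polynomial of
  \<open>M\<close> is evaluated at \<open>1 + t\<close> and re-expanded in powers of
  \<open>t\<close>.\<close>

lemma steiner_formula_shift:
  fixes V :: "nat \<Rightarrow> real" and M E :: "(real ^ 'n) set"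
  assumes "convex E"
    and vol: "\<And>t. 0 < t \<Longrightarrow> measure lebesgue (M + (\<lambda>x. t *\<^sub>R x) ` E)
      = (\<Sum>m\<le>CARD('n). real (CARD('n) choose m) * V m * t ^ m)"
  shows "steiner_formula (M + E) E
    (\<lambda>i. if i \<le> CARD('n) then \<Sum>m\<le>CARD('n). real ((CARD('n) - i) choose (CARD('n) - m)) * V m else 0)"
    (is "steiner_formula _ _ ?w")
  unfolding steiner_formula_def
proof (intro conjI allI impI)
  let ?n = "CARD('n)"
  fix t :: real assume t: "0 \<le> t"
  have "(1 + t) ^ m = (\<Sum>i\<le>?n. real (m choose i) * t ^ i)" if "m \<le> ?n" for m
  proof -
    have "(1 + t) ^ m = (\<Sum>i\<le>m. real (m choose i) * t ^ i)"
      using binomial_ring[of t 1 m] by (simp add: add.commute)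
    also have "\<dots> = (\<Sum>i\<le>?n. real (m choose i) * t ^ i)"
      using that by (intro sum.mono_neutral_left) auto
    finally show ?thesis .
  qed
  then have "(\<Sum>m\<le>?n. real (?n choose m) * V m * (1 + t) ^ m)
      = (\<Sum>m\<le>?n. \<Sum>i\<le>?n. real (?n choose m) * V m * (real (m choose i) * t ^ i))"
    by (simp add: sum_distrib_left)
  also have "\<dots> = (\<Sum>i\<le>?n. \<Sum>m\<le>?n. real (?n choose m) * V m * (real (m choose i) * t ^ i))"
    by (rule sum.swap)
  also have "\<dots> = (\<Sum>i\<le>?n. real (?n choose i) * ?w i * t ^ i)"
  proof (intro sum.cong refl)
    fix i assume i: "i \<in> {..?n}"
    have "real (?n choose m) * V m * (real (m choose i) * t ^ i)
        = real (?n choose i) * t ^ i * (real ((?n - i) choose (?n - m)) * V m)" if "m \<in> {..?n}" for m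
    proof -
      have "real (?n choose m) * real (m choose i) = real (?n choose i) * real ((?n - i) choose (?n - m))"
        using choose_mult_complement[of m ?n i] that i by (simp flip: of_nat_mult)
      then show ?thesis by (metis (no_types, lifting) mult.assoc mult.commute)
    qed
    then have "(\<Sum>m\<le>?n. real (?n choose m) * V m * (real (m choose i) * t ^ i))
        = real (?n choose i) * t ^ i * (\<Sum>m\<le>?n. real ((?n - i) choose (?n - m)) * V m)"
      unfolding sum_distrib_left by (intro sum.cong refl)
    then show "(\<Sum>m\<le>?n. real (?n choose m) * V m * (real (m choose i) * t ^ i)) = real (?n choose i) * ?w i * t ^ i"
      using i by (simp add: mult_ac)
  qed
  finally have "(\<Sum>m\<le>?n. real (?n choose m) * V m * (1 + t) ^ m) = (\<Sum>i = 0..?n. real (?n choose i) * ?w i * t ^ i)"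
    by (simp only: atLeast0AtMost)
  moreover have "M + E + (\<lambda>x. t *\<^sub>R x) ` E = M + (\<lambda>x. (1 + t) *\<^sub>R x) ` E"
    by (simp only: add.assoc convex_Minkowski_dilate[OF \<open>convex E\<close> t])
  \<comment> \<open>The volume formula for positive dilations also covers \<open>t = 0\<close>,
    because it is used at \<open>1 + t\<close>.\<close>
  ultimately show "measure lebesgue (M + E + (\<lambda>x. t *\<^sub>R x) ` E) = (\<Sum>i = 0..?n. real (?n choose i) * ?w i * t ^ i)"
    using vol[of "1 + t"] t by simp
qed simp

text \<open>After exchanging the sums, the inner one is the alternating convolution with
  \<open>a = n - l\<close>, \<open>b = n - r\<close> and \<open>c = n - m\<close>, where
  \<open>n = CARD('n)\<close>. It vanishes for \<open>m > l\<close>, which truncates the outer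
  sum.\<close>

lemma quermass_diff_shift:
  fixes V :: "nat \<Rightarrow> real" and K E :: "(real ^ 'n) set"
  assumes W: "steiner_formula K E
      (\<lambda>i. if i \<le> CARD('n) then \<Sum>m\<le>CARD('n). real ((CARD('n) - i) choose (CARD('n) - m)) * V m else 0)"
    and r: "r \<le> l" and l: "l \<le> CARD('n)"
  shows "quermass_diff K E l r = (\<Sum>m\<le>l. V m * real ((l - r) choose (l - m)))"
proof -
  let ?n = "CARD('n)"
  have "quermass_diff K E l r
      = (\<Sum>q\<le>?n - l. \<Sum>m\<le>?n. V m * ((-1) ^ q * real ((?n - l) choose q) * real ((?n - r - q) choose (?n - m))))"
    unfolding quermass_diff_def quermassintegral_eqI[OF W] atLeast0AtMost
  proof (intro sum.cong refl)
    fix q assume "q \<in> {..?n - l}"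
    then have "r + q \<le> ?n" using r l by simp
    then show "real (?n - l choose q) * (-1) ^ q *
        (if r + q \<le> ?n then \<Sum>m\<le>?n. real ((?n - (r + q)) choose (?n - m)) * V m else 0)
      = (\<Sum>m\<le>?n. V m * ((-1) ^ q * real ((?n - l) choose q) * real ((?n - r - q) choose (?n - m))))"
      by (simp add: sum_distrib_left mult_ac)
  qed
  also have "\<dots> = (\<Sum>m\<le>?n. V m * (\<Sum>q\<le>?n - l. (-1) ^ q * real ((?n - l) choose q) * real ((?n - r - q) choose (?n - m))))"
    by (subst sum.swap) (simp only: sum_distrib_left)
  also have "\<dots> = (\<Sum>m\<le>?n. V m * (if ?n - l \<le> ?n - m then real ((?n - r - (?n - l)) choose (?n - m - (?n - l))) else 0))"
    using r l by (subst alternating_binomial_convolution) auto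
  also have "\<dots> = (\<Sum>m\<le>l. V m * (if ?n - l \<le> ?n - m then real ((?n - r - (?n - l)) choose (?n - m - (?n - l))) else 0))"
    using l by (intro sum.mono_neutral_right) auto
  also have "\<dots> = (\<Sum>m\<le>l. V m * real ((l - r) choose (l - m)))"
  proof (intro sum.cong refl)
    fix m assume "m \<in> {..l}"
    then have "?n - l \<le> ?n - m" "?n - r - (?n - l) = l - r" "?n - m - (?n - l) = l - m"
      using r l by auto
    then show "V m * (if ?n - l \<le> ?n - m then real ((?n - r - (?n - l)) choose (?n - m - (?n - l))) else 0)
        = V m * real ((l - r) choose (l - m))" by simp
  qed
  finally show ?thesis .
qed

section \<open>The inequality and its equality case\<close>

theorem theorem3p1:
  fixes M E K :: "(real ^ 'n) set" and i j k l :: nat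
  assumes "convex_body M" and "convex_body E"
    and "aff_dim E = int CARD('n)"
    and "K = M + E"
    and "i < j" and "j < k" and "k \<le> l" and "l \<le> CARD('n)"
  shows "(real k - real j) * quermass_diff K E l i + (real i - real k) * quermass_diff K E l j
            + (real j - real i) * quermass_diff K E l k \<ge> 0
    \<and> ((real k - real j) * quermass_diff K E l i + (real i - real k) * quermass_diff K E l j
            + (real j - real i) * quermass_diff K E l k = 0
        \<longleftrightarrow> aff_dim M \<le> int CARD('n) - int l + 1)"
proof -
  let ?n = "CARD('n)"
  obtain v where v: "\<And>t. 0 < t \<Longrightarrow> measure lebesgue (M + (\<lambda>x. t *\<^sub>R x) ` E) = (\<Sum>i\<le>?n. v i * t ^ i)"
    and v_nonneg: "\<And>i. 0 \<le> v i"
    and v_zero: "\<And>i. i \<le> ?n \<Longrightarrow> v i = 0 \<longleftrightarrow> aff_dim M + int i < int ?n"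
    using Minkowski_sum_volume[OF assms(1-3)] by blast
  \<comment> \<open>For \<open>m \<le> CARD('n)\<close> this is the quermassintegral of index
    \<open>m\<close> of \<open>M\<close> relative to \<open>E\<close>.\<close>
  define V where "V m = v m / real (?n choose m)" for m
  have V_nonneg: "0 \<le> V m" for m unfolding V_def using v_nonneg by simp
  have V_zero: "V m = 0 \<longleftrightarrow> aff_dim M + int m < int ?n" if "m \<le> ?n" for m
    using v_zero[OF that] binomial_eq_0_iff[of ?n m] that by (simp add: V_def)
  have "convex E" using assms(2) by (simp add: convex_body_def)
  moreover have "measure lebesgue (M + (\<lambda>x. t *\<^sub>R x) ` E) = (\<Sum>m\<le>?n. real (?n choose m) * V m * t ^ m)"
    if "0 < t" for t
    unfolding v[OF that] V_def by (intro sum.cong refl) (simp add: binomial_eq_0_iff)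
  ultimately have W: "steiner_formula K E
      (\<lambda>i. if i \<le> ?n then \<Sum>m\<le>?n. real ((?n - i) choose (?n - m)) * V m else 0)"
    unfolding assms(4) by (rule steiner_formula_shift)
  \<comment> \<open>The convexity defect of a binomial coefficient with lower entry
    \<open>l - m\<close>, taken at the upper entries \<open>l - k < l - j < l - i\<close>.\<close>
  define B where "B m = (real k - real j) * real ((l - i) choose (l - m))
    + (real i - real k) * real ((l - j) choose (l - m)) + (real j - real i) * real ((l - k) choose (l - m))" for m
  define S where "S = (real k - real j) * quermass_diff K E l i + (real i - real k) * quermass_diff K E l j
            + (real j - real i) * quermass_diff K E l k"
  have S: "S = (\<Sum>m\<le>l. V m * B m)"
    using assms(5-8)
    by (simp add: S_def B_def quermass_diff_shift[OF W] sum_distrib_left flip: sum.distrib)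
      (simp add: algebra_simps)
  have le: "l - k < l - j" "l - j < l - i"
    and reals: "real (l - i) = real l - real i" "real (l - j) = real l - real j" "real (l - k) = real l - real k"
    using assms(5-7) by auto
  have B_nonneg: "0 \<le> B m" for m
    using binomial_upper_convex[of "l - k" "l - j" "l - i" "l - m"] le
    unfolding B_def reals by (simp add: algebra_simps)
  have "2 \<le> l" using assms(5-7) by simp
  have B_pos: "0 < B (l - 2)"
    using binomial_2_upper_strictly_convex[OF le] \<open>2 \<le> l\<close>
    unfolding B_def reals by (simp add: algebra_simps)
  \<comment> \<open>For lower entry 0 or 1 the binomial coefficient is affine in its upper entry, so
    the defect is zero.\<close>
  have B_zero: "B m = 0" if "m \<le> l" "l < m + 2" for m
  proof -
    have "l - m = 0 \<or> l - m = 1" using that by auto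
    then show ?thesis by (auto simp: B_def reals algebra_simps)
  qed
  have "S = 0 \<longleftrightarrow> (\<forall>m\<le>l. V m * B m = 0)"
    unfolding S by (subst sum_nonneg_eq_0_iff) (auto simp: V_nonneg B_nonneg)
  also have "\<dots> \<longleftrightarrow> aff_dim M \<le> int ?n - int l + 1"
  proof
    assume "\<forall>m\<le>l. V m * B m = 0"
    \<comment> \<open>The index \<open>l - 2\<close> is the largest one with positive defect.
      Vanishing there means \<open>aff_dim M + l - 2 < n\<close> with \<open>n = CARD('n)\<close>,
      which is the claimed bound by integrality.\<close>
    then have "V (l - 2) = 0" using B_pos by (metis diff_le_self less_irrefl mult_eq_0_iff)
    then show "aff_dim M \<le> int ?n - int l + 1"
      using V_zero[of "l - 2"] \<open>2 \<le> l\<close> assms(8) by simp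
  next
    assume dim: "aff_dim M \<le> int ?n - int l + 1"
    show "\<forall>m\<le>l. V m * B m = 0"
    proof (intro allI impI)
      fix m assume "m \<le> l"
      show "V m * B m = 0"
      proof (cases "l < m + 2")
        case False
        \<comment> \<open>Here \<open>m \<le> l - 2\<close>, so the dimension bound gives
          \<open>aff_dim M + m < CARD('n)\<close>.\<close>
        then have "V m = 0" using V_zero[of m] dim \<open>m \<le> l\<close> assms(8) by simp
        then show ?thesis by simp
      qed (simp add: B_zero[OF \<open>m \<le> l\<close>])
    qed
  qed
  finally have "S = 0 \<longleftrightarrow> aff_dim M \<le> int ?n - int l + 1" .
  moreover have "0 \<le> S"
    unfolding S by (intro sum_nonneg mult_nonneg_nonneg V_nonneg B_nonneg)
  ultimately show ?thesis unfolding S_def by blast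
qed

end
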